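(* Let $\Delta$ be an incidence matrix with $n$ ones. Fix an enumeration $x_1,\dots,x_N$ of $\mathcal U$ (where $N=\#\mathcal U$) adapted to the containment order and run the following greedy procedure: $\Phi_0:=\emptyset$; at step $i$, if the rows $x_1,\dots,x_i$ of $M(\lambda)$ are linearly dependent for one (equivalently, every) $\lambda\in K^{\mathcal U}$ with $\operatorname{supp}\lambda=\Phi_{i-1}$, set $\Phi_i:=\Phi_{i-1}\cup\{x_i\}$, and otherwise set $\Phi_i:=\Phi_{i-1}$; abort if $\Phi_i$, viewed as a set of (undirected) edges on the $n$ ones, contains a cycle. If all $N$ steps complete, the procedure succeeds, with active set $\Phi:=\Phi_N$. Then: (1) The procedure succeeds if and only if $\Delta$ is rigid. (2) On success, $\Phi$ is a forest with at most $n-1$ edges, and $\operatorname{rank}M(\lambda)=\#\mathcal U$ for every $\lambda$ with $\operatorname{supp}\lambda=\Phi$ (in particular for the indicator vector of $\Phi$). (3) On abort at step $i$, the rows $x_1,\dots,x_i$ of $M(\lambda)$ are linearly dependent for every $\lambda\in K^{\mathcal U}$; in particular $\operatorname{rank}M(\lambda)<\#\mathcal U$ identically.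
   Context: $K$ is an algebraically closed field of arbitrary characteristic. An incidence matrix is a zero-one matrix with no zero rows or columns. Let $\Delta$ be an incidence matrix with $n$ ones, at positions $(a_i,b_i)$, $i=1,\dots,n$, listed in lexicographic order. Write $i\vdash j$ if $a_i\le a_j$ and $b_i\le b_j$, and $i\prec j$ if $a_i<a_j$ and $b_i<b_j$. Let $\mathcal V=\{(i,j):i\vdash j\}$ and $\mathcal U=\{(i,j):i\prec j\}$. With $e_{ij}$ the matrix units of $\operatorname{Mat}_n(K)$, let $\mathfrak g=\langle e_{ij}:(i,j)\in\mathcal V\rangle$ (a subalgebra of $\operatorname{Mat}_n(K)$), $\mathfrak u=\langle e_{ij}:(i,j)\in\mathcal U\rangle$ (a two-sided ideal of $\mathfrak g$), and let $G$ be the group of invertible elements of $\mathfrak g$ (those with nonzero diagonal entries), acting on $\mathfrak u$ by conjugation. Rigidity: let $Q$ be the equioriented quiver $1\to2\to\dots\to 2n$ and let $M_\Delta=\bigoplus_{i=1}^nM_{[a_i,b_i+n]}$, where $M_{[a,B]}$ is the indecomposable representation which is one-dimensional at the vertices $a,\dots,B$, zero elsewhere, with identity maps between consecutive vertices of $[a,B]$. $\Delta$ is called rigid if the irreducible component of Lusztig's nilpotent variety attached to $M_\Delta$ (the closure of the conormal bundle of the orbit of $M_\Delta$ in the representation space) contains an open orbit of the base-change group. Under the identifications $\operatorname{Aut}_Q(M_\Delta)\cong G$ and $\operatorname{Ext}^1_Q(M_\Delta,M_\Delta)^*\cong\mathfrak u$ this is equivalent to: $G$ has a dense orbit on $\mathfrak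 u$; this may be used as the definition. For $\lambda\in K^{\mathcal U}$ let $L(\lambda)=\sum_{x\in\mathcal U}\lambda_xe_x\in\mathfrak u$, $\operatorname{supp}\lambda=\{x:\lambda_x\ne0\}$, and let $M(\lambda)$ be the matrix of the linear map $\mathfrak g\to\mathfrak u$, $X\mapsto[X,L(\lambda)]$ in the bases $(e_v)_{v\in\mathcal V}$ and $(e_u)_{u\in\mathcal U}$; rows are indexed by $\mathcal U$ and columns by $\mathcal V$. Explicitly the $((i,j),(i,j'))$-entry is $\lambda_{(j',j)}$ if $(j',j)\in\mathcal U$, the $((i,j),(i',j))$-entry is $-\lambda_{(i,i')}$ if $(i,i')\in\mathcal U$, and all other entries are $0$. Containment order on $\mathcal U$: for $x=(i_x,j_x)$, $y=(i_y,j_y)$, $y\sqsubseteq x$ iff $i_x\vdash i_y$ and $j_y\vdash j_x$. An enumeration of $\mathcal U$ is adapted if it is a linear extension of $\sqsubseteq$ (smaller elements first). An element $(i,j)\in\mathcal U$ is viewed as an edge joining the ones $i$ and $j$. *)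

theory Defs
  imports
    "HOL-Computational_Algebra.Polynomial"
    "Jordan_Normal_Form.DL_Rank"
begin

section \<open>Incidence matrices and the associated relations\<close>

definition incidence_matrix :: "nat mat \<Rightarrow> bool" where
  "incidence_matrix D \<longleftrightarrow>
     (\<forall>a<dim_row D. \<forall>b<dim_col D. D $$ (a, b) \<in> {0, 1}) \<and>
     (\<forall>a<dim_row D. \<exists>b<dim_col D. D $$ (a, b) \<noteq> 0) \<and>
     (\<forall>b<dim_col D. \<exists>a<dim_row D. D $$ (a, b) \<noteq> 0)"

text \<open>
  \<^term>\<open>List.product\<close> lists the positions in lexicographic order. Rows, columns and the ones
  themselves are numbered from 0.
\<close>

definition ones :: "nat mat \<Rightarrow> (nat \<times> nat) list" where
  "ones D = filter (\<lambda>p. D $$ p = 1) (List.product [0..<dim_row D] [0..<dim_col D])"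

definition num_ones :: "nat mat \<Rightarrow> nat" where
  "num_ones D = length (ones D)"

text \<open>The relations $i \vdash j$ and $i \prec j$ on the indices of the ones.\<close>

definition weak_le :: "nat mat \<Rightarrow> nat \<Rightarrow> nat \<Rightarrow> bool" where
  "weak_le D i j \<longleftrightarrow> fst (ones D ! i) \<le> fst (ones D ! j) \<and> snd (ones D ! i) \<le> snd (ones D ! j)"

definition strict_le :: "nat mat \<Rightarrow> nat \<Rightarrow> nat \<Rightarrow> bool" where
  "strict_le D i j \<longleftrightarrow> fst (ones D ! i) < fst (ones D ! j) \<and> snd (ones D ! i) < snd (ones D ! j)"

definition VV :: "nat mat \<Rightarrow> (nat \<times> nat) set" where
  "VV D = {(i, j). i < num_ones D \<and> j < num_ones D \<and> weak_le D i j}"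

definition UU :: "nat mat \<Rightarrow> (nat \<times> nat) set" where
  "UU D = {(i, j). i < num_ones D \<and> j < num_ones D \<and> strict_le D i j}"

section \<open>The algebra, its ideal and the group action\<close>

text \<open>The matrix $\sum_{x \in S} c_x e_x$; values of \<open>c\<close> outside \<open>S\<close> play no role.\<close>

definition unit_comb :: "nat \<Rightarrow> (nat \<times> nat) set \<Rightarrow> (nat \<times> nat \<Rightarrow> 'k::field) \<Rightarrow> 'k mat" where
  "unit_comb n S c = mat n n (\<lambda>x. if x \<in> S then c x else 0)"

definition unit_span :: "nat \<Rightarrow> (nat \<times> nat) set \<Rightarrow> 'k::field mat set" where
  "unit_span n S = range (unit_comb n S)"

definition alg_g :: "nat mat \<Rightarrow> 'k::field mat set" where
  "alg_g D = unit_span (num_ones D) (VV D)"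

definition ideal_u :: "nat mat \<Rightarrow> 'k::field mat set" where
  "ideal_u D = unit_span (num_ones D) (UU D)"

text \<open>
  The orbit of \<open>X\<close> under conjugation by the group of units of the algebra; \<open>h\<close> is the inverse
  of \<open>g\<close>.
\<close>

definition conj_orbit :: "nat mat \<Rightarrow> 'k::field mat \<Rightarrow> 'k mat set" where
  "conj_orbit D X =
     {g * X * h | g h. g \<in> alg_g D \<and> h \<in> alg_g D \<and>
        g * h = 1\<^sub>m (num_ones D) \<and> h * g = 1\<^sub>m (num_ones D)}"

section \<open>Zariski density and rigidity\<close>

text \<open>Polynomial functions in the matrix entries at the positions in \<open>S\<close>.\<close>

inductive_set poly_funs :: "(nat \<times> nat) set \<Rightarrow> ('k::field mat \<Rightarrow> 'k) set"
  for S :: "(nat \<times> nat) set" where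
  const: "(\<lambda>_. c) \<in> poly_funs S"
| coord: "x \<in> S \<Longrightarrow> (\<lambda>X. X $$ x) \<in> poly_funs S"
| add: "f \<in> poly_funs S \<Longrightarrow> g \<in> poly_funs S \<Longrightarrow> (\<lambda>X. f X + g X) \<in> poly_funs S"
| mult: "f \<in> poly_funs S \<Longrightarrow> g \<in> poly_funs S \<Longrightarrow> (\<lambda>X. f X * g X) \<in> poly_funs S"

definition zariski_closed :: "nat \<Rightarrow> (nat \<times> nat) set \<Rightarrow> 'k::field mat set \<Rightarrow> bool" where
  "zariski_closed n S Z \<longleftrightarrow>
     (\<exists>F \<subseteq> poly_funs S. Z = {X \<in> unit_span n S. \<forall>f\<in>F. f X = 0})"

definition zariski_dense :: "nat \<Rightarrow> (nat \<times> nat) set \<Rightarrow> 'k::field mat set \<Rightarrow> bool" where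
  "zariski_dense n S Y \<longleftrightarrow> Y \<subseteq> unit_span n S \<and>
     (\<forall>Z. zariski_closed n S Z \<and> Y \<subseteq> Z \<longrightarrow> Z = unit_span n S)"

text \<open>
  Rigidity of the incidence matrix over the field \<open>'k\<close>, in the form: the unit group of the algebra
  has a dense orbit on the ideal.
\<close>

definition rigid :: "'k::field itself \<Rightarrow> nat mat \<Rightarrow> bool" where
  "rigid _ D \<longleftrightarrow>
     (\<exists>X \<in> (ideal_u D :: 'k mat set). zariski_dense (num_ones D) (UU D) (conj_orbit D X))"

section \<open>The matrix $M(\lambda)$\<close>

definition supp :: "nat mat \<Rightarrow> (nat \<times> nat \<Rightarrow> 'k::field) \<Rightarrow> (nat \<times> nat) set" where
  "supp D lam = {x \<in> UU D. lam x \<noteq> 0}"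

definition Lmat :: "nat mat \<Rightarrow> (nat \<times> nat \<Rightarrow> 'k::field) \<Rightarrow> 'k mat" where
  "Lmat D lam = unit_comb (num_ones D) (UU D) lam"

definition matrix_unit :: "nat \<Rightarrow> nat \<times> nat \<Rightarrow> 'k::field mat" where
  "matrix_unit n v = mat n n (\<lambda>x. if x = v then 1 else 0)"

definition commutator :: "'k::field mat \<Rightarrow> 'k mat \<Rightarrow> 'k mat" where
  "commutator X Y = X * Y - Y * X"

definition VV_list :: "nat mat \<Rightarrow> (nat \<times> nat) list" where
  "VV_list D = filter (\<lambda>v. v \<in> VV D) (List.product [0..<num_ones D] [0..<num_ones D])"

text \<open>
  The matrix of $X \mapsto [X, L(\lambda)]$. Its rows are ordered by the given enumeration \<open>xs\<close> of
  \<^term>\<open>UU D\<close>, its columns by the lexicographic enumeration of \<^term>\<open>VV D\<close>. The lemma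
  \<open>Mmat_entry\<close> below gives the entries explicitly.
\<close>

definition Mmat :: "nat mat \<Rightarrow> (nat \<times> nat) list \<Rightarrow> (nat \<times> nat \<Rightarrow> 'k::field) \<Rightarrow> 'k mat" where
  "Mmat D xs lam = mat (length xs) (length (VV_list D))
     (\<lambda>(r, c). commutator (matrix_unit (num_ones D) (VV_list D ! c)) (Lmat D lam) $$ (xs ! r))"

text \<open>
  Linear dependence of the first \<open>i\<close> rows as a family, so that repeated rows count as dependent
  (which the set-based \<open>lin_dep\<close> would not see).
\<close>

definition rows_dependent :: "'k::field mat \<Rightarrow> nat \<Rightarrow> bool" where
  "rows_dependent A i \<longleftrightarrow>
     (\<exists>c. (\<exists>r<i. c r \<noteq> 0) \<and> (\<forall>l<dim_col A. (\<Sum>r<i. c r * A $$ (r, l)) = 0))"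

definition mat_rank :: "'k::field mat \<Rightarrow> nat" where
  "mat_rank A = vec_space.rank (dim_row A) A"

section \<open>The greedy procedure\<close>

text \<open>\<open>contained D y x\<close> is $y \sqsubseteq x$.\<close>

definition contained :: "nat mat \<Rightarrow> nat \<times> nat \<Rightarrow> nat \<times> nat \<Rightarrow> bool" where
  "contained D y x \<longleftrightarrow> weak_le D (fst x) (fst y) \<and> weak_le D (snd y) (snd x)"

definition adapted_enumeration :: "nat mat \<Rightarrow> (nat \<times> nat) list \<Rightarrow> bool" where
  "adapted_enumeration D xs \<longleftrightarrow> distinct xs \<and> set xs = UU D \<and>
     (\<forall>k<length xs. \<forall>l<length xs. contained D (xs ! k) (xs ! l) \<longrightarrow> k \<le> l)"

text \<open>
  Pairs are read as undirected edges. Since \<^term>\<open>UU D\<close> contains no loop and never both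
  \<open>(i, j)\<close> and \<open>(j, i)\<close>, subsets of it are simple graphs, and cycles have length at least 3.
\<close>

definition has_cycle :: "(nat \<times> nat) set \<Rightarrow> bool" where
  "has_cycle E \<longleftrightarrow> (\<exists>ws. 3 \<le> length ws \<and> distinct ws \<and>
     (\<forall>k<length ws. (ws ! k, ws ! (Suc k mod length ws)) \<in> E \<union> E\<inverse>))"

definition forest_on :: "nat set \<Rightarrow> (nat \<times> nat) set \<Rightarrow> bool" where
  "forest_on W E \<longleftrightarrow> E \<subseteq> W \<times> W \<and> \<not> has_cycle E"

text \<open>
  \<open>greedy TYPE('k) D xs i\<close> is the state after \<open>i\<close> steps: \<open>Some\<close> $\Phi_i$, or \<open>None\<close> if the
  procedure has been aborted at step \<open>i\<close> or before. As \<open>xs\<close> is 0-based, step \<open>Suc i\<close> handles the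
  element \<open>xs ! i\<close>.
\<close>

primrec greedy ::
  "'k::field itself \<Rightarrow> nat mat \<Rightarrow> (nat \<times> nat) list \<Rightarrow> nat \<Rightarrow> (nat \<times> nat) set option" where
  "greedy T D xs 0 = Some {}"
| "greedy T D xs (Suc i) =
     (case greedy T D xs i of
        None \<Rightarrow> None
      | Some P \<Rightarrow>
          (let P' = (if \<exists>lam :: nat \<times> nat \<Rightarrow> 'k. supp D lam = P \<and>
                          rows_dependent (Mmat D xs lam) (Suc i)
                     then insert (xs ! i) P else P)
           in if has_cycle P' then None else Some P'))"

section \<open>The entries of $M(\lambda)$\<close>

lemma Mmat_entry:
  fixes lam :: "nat \<times> nat \<Rightarrow> 'a::field"
  assumes r: "r < length xs" "xs ! r = (i, j)" "(i, j) \<in> UU D"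
    and c: "c < length (VV_list D)" "VV_list D ! c = (k, l)"
  shows "Mmat D xs lam $$ (r, c) =
    (if k = i \<and> (l, j) \<in> UU D then lam (l, j)
     else if l = j \<and> (i, k) \<in> UU D then - lam (i, k) else 0)"
proof -
  let ?n = "num_ones D"
  have "(k, l) \<in> set (VV_list D)"
    using c by (metis nth_mem)
  then have kl: "k < ?n" "l < ?n"
    by (auto simp: VV_list_def)
  have ij: "i < ?n" "j < ?n"
    using r(3) by (auto simp: UU_def)
  have EL: "(matrix_unit ?n (k, l) * Lmat D lam) $$ (i, j) =
      (\<Sum>m<?n. if m = l then (if i = k \<and> (m, j) \<in> UU D then lam (m, j) else 0) else 0)"
    using ij kl
    by (simp add: matrix_unit_def Lmat_def unit_comb_def scalar_prod_def atLeast0LessThan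
        del: sum.delta sum.delta', intro sum.cong) auto
  have LE: "(Lmat D lam * matrix_unit ?n (k, l)) $$ (i, j) =
      (\<Sum>m<?n. if m = k then (if j = l \<and> (i, m) \<in> UU D then lam (i, m) else 0) else 0)"
    using ij kl
    by (simp add: matrix_unit_def Lmat_def unit_comb_def scalar_prod_def atLeast0LessThan
        del: sum.delta sum.delta', intro sum.cong) auto
  have dims: "(matrix_unit ?n (k, l) :: 'a mat) \<in> carrier_mat ?n ?n" "Lmat D lam \<in> carrier_mat ?n ?n"
    by (auto simp: matrix_unit_def Lmat_def unit_comb_def)
  have "Mmat D xs lam $$ (r, c) =
      (matrix_unit ?n (k, l) * Lmat D lam) $$ (i, j) - (Lmat D lam * matrix_unit ?n (k, l)) $$ (i, j)"
    using r c dims[THEN carrier_matD(1)] dims[THEN carrier_matD(2)] ij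
    by (simp add: Mmat_def commutator_def)
  moreover have "\<not> (i = k \<and> (l, j) \<in> UU D \<and> j = l)"
    by (auto simp: UU_def strict_le_def)
  ultimately show ?thesis
    unfolding EL LE using kl by auto
qed

end

theory Submission
  imports Defs "HOL-Library.Transitive_Closure_Table"
begin

text \<open>
  The first \<open>m\<close> rows of $M(\lambda)$ are independent iff $X \mapsto [X, L(\lambda)]$ maps onto
  the quotient of $\mathfrak u$ that keeps the first \<open>m\<close> coordinates; this quotient is a bimodule because
  the enumeration is adapted. The key invariant is that every \<open>X\<close> commuting with $L(\lambda)$ in the
  quotient has equal diagonal entries at the two ends of each edge of $\Phi$: an edge is added only if,
  for such \<open>X\<close>, the new coordinate of $[X, L(\lambda)]$ vanishes, and a nonzero coefficient $t$ at
  the new edge then contributes $t (X_{aa} - X_{bb})$.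

  If the new edge $(a, b)$ joins different components, the indicator of one of them is a diagonal matrix
  with nonzero contribution, so independence is regained. If the edge closes a cycle, the
  contribution vanishes for all $t$, so the whole line over $L(\lambda)$ consists of dependent
  points. Generic points are conjugate into this line, which gives (3), and no orbit is dense, since
  different points of the line are separated by the ranks of the maps $X \mapsto X Y - Z X$.
  Conversely, independence of all rows makes the orbit of $L(\lambda)$ dense. Openness of orbits is
  obtained from Cramer's rule and polynomials on lines, hence in every characteristic.
\<close>

section \<open>Right inverses and rank\<close>

text \<open>Two points shape the argument. That the tangent map is nowhere onto excludes a dense
  orbit only after some dimension theory or a discussion of separability. The two arguments in X
  \<mapsto> X Y - Z X replace this. Since Y and Z can be conjugated independently, the rank is a
  function of a pair of orbits; surjectivity is an open condition on Z alone; and an invertible X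
  with X Y = Z X is a conjugating element. So one linear system both produces conjugations and tells
  orbits apart. The other point is that the procedure tests a single vector with a given support,
  while the invariant speaks of all of them. On a forest, arbitrary nonzero edge weights are
  quotients of vertex weights, so a diagonal matrix conjugates any vector with this support into any
  other. Acyclicity is thus used twice: here, and for the diagonal matrix that separates the ends of
  a new edge.\<close>

lemma right_inverse_of_independent:
  fixes a :: "nat \<Rightarrow> 'v \<Rightarrow> 'k::field"
  assumes "finite V"
    and "\<And>c. \<forall>v\<in>V. (\<Sum>r<m. c r * a r v) = 0 \<Longrightarrow> \<forall>r<m. c r = 0"
  shows "\<exists>y. \<forall>r<m. \<forall>s<m. (\<Sum>v\<in>V. a r v * y s v) = (if r = s then 1 else 0)"
  using assms(2)
proof (induction m)
  case 0
  then show ?case by simp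
next
  case (Suc m)
  have "\<forall>r<m. c r = 0" if "\<forall>v\<in>V. (\<Sum>r<m. c r * a r v) = 0" for c
  proof -
    have "\<forall>v\<in>V. (\<Sum>r<Suc m. (if r < m then c r else 0) * a r v) = 0"
      using that by simp
    from Suc.prems[OF this] show ?thesis by (metis less_SucI)
  qed
  then obtain y where y: "\<And>r s. r < m \<Longrightarrow> s < m \<Longrightarrow> (\<Sum>v\<in>V. a r v * y s v) = (if r = s then 1 else 0)"
    using Suc.IH by blast
  define d where "d s = (\<Sum>v\<in>V. a m v * y s v)" for s
  \<comment> \<open>Otherwise row \<open>m\<close> would be the combination of the earlier rows with
    coefficients \<open>d\<close>; the coordinate \<open>w\<close> obtained below witnesses that it
    is not.\<close>
  have "\<exists>v\<in>V. a m v - (\<Sum>s<m. d s * a s v) \<noteq> 0"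
  proof (rule ccontr)
    assume "\<not> ?thesis"
    then have "\<forall>v\<in>V. (\<Sum>r<Suc m. (if r < m then - d r else 1) * a r v) = 0"
      by (simp add: sum_negf)
    from Suc.prems[OF this] have "(if m < m then - d m else 1) = 0" by blast
    then show False by simp
  qed
  then obtain w where w: "w \<in> V" "a m w - (\<Sum>s<m. d s * a s w) \<noteq> 0" by blast
  \<comment> \<open>The indicator of \<open>w\<close>, corrected by the old dual vectors: it pairs
    to 0 with every row below \<open>m\<close> and to \<open>q\<close> with row \<open>m\<close>.
    Hence \<open>z / q\<close> is the new dual vector, and subtracting \<open>e s * z\<close> from
    \<open>y s\<close> repairs its pairing with row \<open>m\<close>.\<close>
  define z where "z v = (if v = w then 1 else 0) - (\<Sum>s<m. a s w * y s v)" for v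
  have az: "(\<Sum>v\<in>V. a r v * z v) = a r w - (\<Sum>s<m. a s w * (\<Sum>v\<in>V. a r v * y s v))" for r
  proof -
    have "(\<Sum>v\<in>V. a r v * z v) = (\<Sum>v\<in>V. (if v = w then a r v else 0) - (\<Sum>s<m. a s w * (a r v * y s v)))"
      by (rule sum.cong) (auto simp: z_def right_diff_distrib sum_distrib_left mult.left_commute)
    also have "\<dots> = a r w - (\<Sum>v\<in>V. \<Sum>s<m. a s w * (a r v * y s v))"
      using w assms(1) by (simp add: sum_subtractf)
    also have "(\<Sum>v\<in>V. \<Sum>s<m. a s w * (a r v * y s v)) = (\<Sum>s<m. a s w * (\<Sum>v\<in>V. a r v * y s v))"
      by (subst sum.swap) (simp add: sum_distrib_left)
    finally show ?thesis .
  qed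
  have az0: "(\<Sum>v\<in>V. a r v * z v) = 0" if "r < m" for r
    using that by (simp add: az y if_distrib[of "\<lambda>x. _ * x"] cong: if_cong)
  define q where "q = a m w - (\<Sum>s<m. d s * a s w)"
  have q: "q \<noteq> 0" using w by (simp add: q_def)
  have azm: "(\<Sum>v\<in>V. a m v * z v) = q"
    unfolding az q_def d_def by (simp add: mult.commute)
  obtain e where e: "\<And>s. e s * q = d s"
    using q that[of "\<lambda>s. d s / q"] by simp
  define y' where "y' s v = (if s = m then z v / q else y s v - e s * z v)" for s v
  have lin: "(\<Sum>v\<in>V. a r v * (y s v - e * z v)) = (\<Sum>v\<in>V. a r v * y s v) - e * (\<Sum>v\<in>V. a r v * z v)" for r s e
    by (simp add: right_diff_distrib sum_subtractf sum_distrib_left mult.left_commute)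
  have lin2: "(\<Sum>v\<in>V. a r v * (z v / q)) = (\<Sum>v\<in>V. a r v * z v) / q" for r
    by (simp add: sum_divide_distrib)
  have "(\<Sum>v\<in>V. a r v * y' s v) = (if r = s then 1 else 0)" if "r < Suc m" "s < Suc m" for r s
  proof (cases "s = m")
    case True
    then show ?thesis using that az0[of r] azm q by (auto simp: y'_def lin2 less_Suc_eq simp del: times_divide_eq_right)
  next
    case False
    then have "s < m" using that by simp
    have "(\<Sum>v\<in>V. a r v * y' s v) = (\<Sum>v\<in>V. a r v * y s v) - e s * (\<Sum>v\<in>V. a r v * z v)"
      using False by (simp add: y'_def lin)
    also have "\<dots> = (if r = s then 1 else 0)"
    proof (cases "r = m")
      case True
      then show ?thesis using False azm e[of s] by (simp add: d_def)
    next
      case r: False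
      then show ?thesis using that az0[of r] y[of r s] \<open>s < m\<close> by simp
    qed
    finally show ?thesis .
  qed
  then show ?case by blast
qed

lemma independent_of_right_inverse:
  fixes a :: "nat \<Rightarrow> 'v \<Rightarrow> 'k::field"
  assumes "\<And>r s. r < m \<Longrightarrow> s < m \<Longrightarrow> (\<Sum>v\<in>V. a r v * y s v) = (if r = s then 1 else 0)"
    and "\<forall>v\<in>V. (\<Sum>r<m. c r * a r v) = 0" and "s < m"
  shows "c s = 0"
proof -
  have "0 = (\<Sum>v\<in>V. (\<Sum>r<m. c r * a r v) * y s v)"
    using assms(2) by simp
  also have "\<dots> = (\<Sum>r<m. c r * (\<Sum>v\<in>V. a r v * y s v))"
    by (subst sum_distrib_left, subst sum.swap) (simp add: sum_distrib_left sum_distrib_right mult.assoc)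
  also have "\<dots> = c s"
    using assms(1,3) by (simp add: if_distrib[of "\<lambda>x. _ * x"] cong: if_cong)
  finally show ?thesis by simp
qed

lemma right_inverse_iff_independent:
  fixes a :: "nat \<Rightarrow> 'v \<Rightarrow> 'k::field"
  assumes "finite V"
  shows "(\<exists>y. \<forall>r<m. \<forall>s<m. (\<Sum>v\<in>V. a r v * y s v) = (if r = s then 1 else 0)) \<longleftrightarrow>
    (\<forall>c. (\<forall>v\<in>V. (\<Sum>r<m. c r * a r v) = 0) \<longrightarrow> (\<forall>r<m. c r = 0))"
proof
  assume "\<exists>y. \<forall>r<m. \<forall>s<m. (\<Sum>v\<in>V. a r v * y s v) = (if r = s then 1 else 0)"
  then obtain y where "\<And>r s. r < m \<Longrightarrow> s < m \<Longrightarrow> (\<Sum>v\<in>V. a r v * y s v) = (if r = s then 1 else 0)"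
    by blast
  from independent_of_right_inverse[OF this]
  show "\<forall>c. (\<forall>v\<in>V. (\<Sum>r<m. c r * a r v) = 0) \<longrightarrow> (\<forall>r<m. c r = 0)" by blast
qed (use right_inverse_of_independent[OF assms] in blast)

lemma rows_dependent_mono:
  assumes "rows_dependent A i" "i \<le> j"
  shows "rows_dependent A j"
proof -
  obtain c where c: "\<exists>r<i. c r \<noteq> 0" "\<forall>l<dim_col A. (\<Sum>r<i. c r * A $$ (r, l)) = 0"
    using assms(1) by (auto simp: rows_dependent_def)
  have "(\<Sum>r<j. (if r < i then c r else 0) * A $$ (r, l)) = (\<Sum>r<i. c r * A $$ (r, l))" for l
    using assms(2) by (intro sum.mono_neutral_cong_right) auto
  then show ?thesis
    unfolding rows_dependent_def using c assms(2)
    by (intro exI[of _ "\<lambda>r. if r < i then c r else 0"]) (auto intro: less_le_trans)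
qed

lemma not_rows_dependent_iff_right_inverse:
  fixes A :: "'k::field mat"
  shows "\<not> rows_dependent A m \<longleftrightarrow>
    (\<exists>y. \<forall>r<m. \<forall>s<m. (\<Sum>l<dim_col A. A $$ (r, l) * y s l) = (if r = s then 1 else 0))"
  by (subst right_inverse_iff_independent) (auto simp: rows_dependent_def)

text \<open>The rank is the size of a maximal independent set of columns, and n independent columns
  form a basis of the whole space. Full rank thus becomes solvability for every right-hand side, the
  form in which right inverses are found.\<close>

lemma (in vec_space) rank_eq_n_iff:
  assumes A: "A \<in> carrier_mat n nc"
  shows "rank A \<le> n" and "rank A = n \<longleftrightarrow> (\<forall>w\<in>carrier_vec n. \<exists>v\<in>carrier_vec nc. A *\<^sub>v v = w)"
proof -
  have cols: "set (cols A) \<subseteq> carrier_vec n" using cols_dim A by blast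
  obtain S where S: "maximal S (\<lambda>T. T \<subseteq> set (cols A) \<and> lin_indpt T)" "finite S"
    using maximal_exists_superset[of "set (cols A)" "(\<lambda>T. T \<subseteq> set (cols A) \<and> lin_indpt T)" "{}"]
    by (metis (no_types, lifting) List.finite_set empty_subsetI finite_lin_indpt2 finite.emptyI empty_iff)
  have rk: "rank A = card S" using rank_card_indpt[OF A S(1)] .
  have S': "S \<subseteq> set (cols A)" "lin_indpt S" using S(1) by (auto simp: maximal_def)
  then have Sc: "S \<subseteq> carrier_vec n" using cols by blast
  show "rank A \<le> n" using li_le_dim(2)[of S] S' Sc rk dim_is_n by (auto simp: fin_dim)
  have cs: "col_space A = {y \<in> carrier_vec n. \<exists>x\<in>carrier_vec nc. A *\<^sub>v x = y}"
    using col_space_eq[OF A] A by auto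
  have "rank A = n \<longleftrightarrow> col_space A = carrier_vec n"
  proof
    assume "rank A = n"
    then have "basis S"
      using dim_li_is_basis[of S] S S' Sc rk dim_is_n by auto
    then have "span S = carrier_vec n" by (auto simp: basis_def)
    then show "col_space A = carrier_vec n"
      using span_is_monotone[OF S'(1)] cols span_is_subset2[of "set (cols A)"] by (auto simp: col_space_def)
  next
    assume "col_space A = carrier_vec n"
    then have "span_vs (set (cols A)) = V"
      by (simp add: col_space_def)
    then show "rank A = n"
      unfolding rank_def using dim_is_n by simp
  qed
  then show "rank A = n \<longleftrightarrow> (\<forall>w\<in>carrier_vec n. \<exists>v\<in>carrier_vec nc. A *\<^sub>v v = w)"
    unfolding cs by auto
qed

lemma mat_rank_le_dim_row: "mat_rank A \<le> dim_row A"
  unfolding mat_rank_def by (rule vec_space.rank_eq_n_iff(1)[of _ _ "dim_col A"]) auto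

text \<open>Connects the rank in the theorem with the row condition that the procedure tests: a
  right inverse solves A v = w for every w, and solutions for the unit vectors are the columns of a
  right inverse.\<close>

lemma mat_rank_eq_dim_row_iff: "mat_rank A = dim_row A \<longleftrightarrow> \<not> rows_dependent A (dim_row A)"
proof -
  let ?n = "dim_row A" and ?k = "dim_col A"
  have A: "A \<in> carrier_mat ?n ?k" by auto
  have mv: "(A *\<^sub>v v) $ r = (\<Sum>l<?k. A $$ (r, l) * v $ l)" if "r < ?n" "v \<in> carrier_vec ?k" for r v
    using that by (auto simp: scalar_prod_def atLeast0LessThan intro!: sum.cong)
  have "(\<forall>w\<in>carrier_vec ?n. \<exists>v\<in>carrier_vec ?k. A *\<^sub>v v = w) \<longleftrightarrow> \<not> rows_dependent A ?n"
    unfolding not_rows_dependent_iff_right_inverse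
  proof
    assume H: "\<forall>w\<in>carrier_vec ?n. \<exists>v\<in>carrier_vec ?k. A *\<^sub>v v = w"
    have "\<exists>v\<in>carrier_vec ?k. A *\<^sub>v v = unit_vec ?n s" for s
      using H by auto
    then obtain v where v: "\<And>s. v s \<in> carrier_vec ?k" "\<And>s. A *\<^sub>v v s = unit_vec ?n s" by metis
    have "(\<Sum>l<?k. A $$ (r, l) * v s $ l) = (if r = s then 1 else 0)" if "r < ?n" "s < ?n" for r s
      using mv[OF that(1) v(1)[of s]] v(2)[of s] that by simp
    then show "\<exists>y. \<forall>r<?n. \<forall>s<?n. (\<Sum>l<?k. A $$ (r, l) * y s l) = (if r = s then 1 else 0)"
      by (intro exI[of _ "\<lambda>s l. v s $ l"]) auto
  next
    assume "\<exists>y. \<forall>r<?n. \<forall>s<?n. (\<Sum>l<?k. A $$ (r, l) * y s l) = (if r = s then 1 else 0)"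
    then obtain y where y: "\<And>r s. r < ?n \<Longrightarrow> s < ?n \<Longrightarrow> (\<Sum>l<?k. A $$ (r, l) * y s l) = (if r = s then 1 else 0)"
      by blast
    show "\<forall>w\<in>carrier_vec ?n. \<exists>v\<in>carrier_vec ?k. A *\<^sub>v v = w"
    proof
      fix w :: "'a vec" assume w: "w \<in> carrier_vec ?n"
      define v where "v = vec ?k (\<lambda>l. \<Sum>s<?n. y s l * w $ s)"
      have v: "v \<in> carrier_vec ?k" by (simp add: v_def)
      have "(A *\<^sub>v v) $ r = w $ r" if r: "r < ?n" for r
      proof -
        have "(A *\<^sub>v v) $ r = (\<Sum>l<?k. \<Sum>s<?n. A $$ (r, l) * y s l * w $ s)"
          using mv[OF r v] by (simp add: v_def sum_distrib_left mult.assoc)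
        also have "\<dots> = (\<Sum>s<?n. (\<Sum>l<?k. A $$ (r, l) * y s l) * w $ s)"
          by (subst sum.swap) (simp add: sum_distrib_right)
        also have "\<dots> = w $ r"
          using y r by (simp add: if_distrib[of "\<lambda>x. x * _"] cong: if_cong)
        finally show ?thesis .
      qed
      then have "A *\<^sub>v v = w" using w by (intro eq_vecI) auto
      then show "\<exists>v\<in>carrier_vec ?k. A *\<^sub>v v = w" using v by blast
    qed
  qed
  then show ?thesis
    unfolding mat_rank_def using vec_space.rank_eq_n_iff(2)[OF A] by simp
qed

section \<open>Cycles and forests\<close>

abbreviation connected_in :: "(nat \<times> nat) set \<Rightarrow> (nat \<times> nat) set" where
  "connected_in E \<equiv> (E \<union> E\<inverse>)\<^sup>*"

lemma has_cycle_mono: "has_cycle E \<Longrightarrow> E \<subseteq> F \<Longrightarrow> has_cycle F"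
  unfolding has_cycle_def by (elim exE conjE, intro exI conjI) auto

lemma connected_in_sym: "(a, b) \<in> connected_in E \<longleftrightarrow> (b, a) \<in> connected_in E"
proof -
  have "sym (connected_in E)" by (intro sym_rtrancl sym_Un_converse)
  then show ?thesis by (auto dest: symD)
qed

text \<open>A simple path from \<open>a\<close> to \<open>b\<close> is closed up by the new edge. As
  neither orientation of that edge is in \<open>E\<close>, the path has at least two edges, so the
  cycle has the required three vertices.\<close>

lemma has_cycle_insert_if_connected:
  assumes "(a, b) \<in> connected_in E" "a \<noteq> b" "(a, b) \<notin> E" "(b, a) \<notin> E"
  shows "has_cycle (insert (a, b) E)"
proof -
  define R where "R = (\<lambda>x y. (x, y) \<in> E \<union> E\<inverse>)"
  have "R\<^sup>*\<^sup>* a b"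
    using assms(1)
  proof (induction rule: rtrancl_induct)
    case (step y z)
    then show ?case unfolding R_def by (metis (mono_tags, lifting) rtranclp.rtrancl_into_rtrancl)
  qed simp
  then obtain ys where ys: "rtrancl_path R a ys b" "distinct (a # ys)"
    unfolding rtranclp_eq_rtrancl_path by (meson rtrancl_path_distinct)
  have ne: "ys \<noteq> []"
    using ys(1) assms(2) by (auto elim: rtrancl_path.cases)
  then have last: "last ys = b" using ys(1) rtrancl_path_last by fast
  have step: "R ((a # ys) ! k) (ys ! k)" if "k < length ys" for k
    using rtrancl_path_nth[OF ys(1) that] .
  have len: "length ys \<ge> 2"
  proof (rule ccontr)
    assume "\<not> ?thesis"
    with ne obtain y where "ys = [y]" by (cases ys; cases "tl ys") auto
    then show False using last step[of 0] assms by (auto simp: R_def)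
  qed
  have "((a # ys) ! k, (a # ys) ! (Suc k mod length (a # ys))) \<in> insert (a, b) E \<union> (insert (a, b) E)\<inverse>"
    if "k < length (a # ys)" for k
  proof (cases "k = length ys")
    case True
    then have "(a # ys) ! k = b" using ne last by (simp add: last_conv_nth nth_Cons')
    then show ?thesis using True by simp
  next
    case False
    then show ?thesis using that step[of k] by (auto simp: R_def)
  qed
  then show ?thesis
    unfolding has_cycle_def using ys(2) len by (intro exI[of _ "a # ys"]) auto
qed

text \<open>Some step of the cycle is not an edge of \<open>E\<close>, hence is the new edge. All
  other steps stay in \<open>E\<close>, and following them around the cycle leads from one end of
  the new edge to the other.\<close>

lemma connected_if_has_cycle_insert:
  assumes "has_cycle (insert (a, b) E)" "\<not> has_cycle E"
  shows "(a, b) \<in> connected_in E"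
proof -
  obtain ws where ws: "3 \<le> length ws" "distinct ws"
    "\<And>k. k < length ws \<Longrightarrow> (ws ! k, ws ! (Suc k mod length ws)) \<in> insert (a, b) E \<union> (insert (a, b) E)\<inverse>"
    using assms(1) unfolding has_cycle_def by blast
  let ?l = "length ws"
  obtain k where k: "k < ?l" "(ws ! k, ws ! (Suc k mod ?l)) \<notin> E \<union> E\<inverse>"
    using assms(2) ws unfolding has_cycle_def by blast
  then have ab: "(ws ! k, ws ! (Suc k mod ?l)) \<in> {(a, b), (b, a)}"
    using ws(3)[OF k(1)] by auto
  have mod: "Suc j mod ?l < ?l" for j using ws(1) by (intro mod_less_divisor) linarith
  have Smod: "Suc j mod ?l = (if Suc j = ?l then 0 else Suc j)" if "j < ?l" for j
    using that by auto
  have eq: "ws ! i = ws ! j \<longleftrightarrow> i = j" if "i < ?l" "j < ?l" for i j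
    using that ws(2) by (simp add: nth_eq_iff_index_eq)
  \<comment> \<open>A second use of the new edge would have to run in the opposite direction, since
    the vertices are distinct; then each of the two steps would follow the other, and the cycle
    would have length 2.\<close>
  have other: "(ws ! j, ws ! (Suc j mod ?l)) \<in> E \<union> E\<inverse>" if "j < ?l" "j \<noteq> k" for j
  proof (rule ccontr)
    assume "\<not> ?thesis"
    then have "(ws ! j, ws ! (Suc j mod ?l)) \<in> {(a, b), (b, a)}"
      using ws(3)[OF that(1)] by auto
    moreover have "ws ! j \<noteq> ws ! k" using eq that k by blast
    ultimately have "ws ! j = ws ! (Suc k mod ?l)" "ws ! (Suc j mod ?l) = ws ! k"
      using ab by auto
    then have "j = Suc k mod ?l" "Suc j mod ?l = k"
      using eq[OF that(1) mod[of k]] eq[OF mod[of j] k(1)] by auto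
    then show False
      using Smod[OF that(1)] Smod[OF k(1)] ws(1) by (cases "Suc j = ?l"; cases "Suc k = ?l") simp_all
  qed
  have path: "(ws ! (Suc k mod ?l), ws ! ((Suc k + j) mod ?l)) \<in> connected_in E" if "j < ?l" for j
    using that
  proof (induction j)
    case 0
    then show ?case by simp
  next
    case (Suc j)
    have "(Suc k + j) mod ?l \<noteq> k"
    proof (cases "Suc k + j < ?l")
      case False
      then have "(Suc k + j) mod ?l = Suc k + j - ?l"
        using k(1) Suc.prems by (simp add: le_mod_geq)
      then show ?thesis using Suc.prems False by linarith
    qed simp
    moreover have "(Suc k + j) mod ?l < ?l" using ws(1) by (intro mod_less_divisor) linarith
    ultimately have "(ws ! ((Suc k + j) mod ?l), ws ! (Suc ((Suc k + j) mod ?l) mod ?l)) \<in> E \<union> E\<inverse>"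
      using other by blast
    moreover have "Suc ((Suc k + j) mod ?l) mod ?l = (Suc k + Suc j) mod ?l"
      by (simp add: mod_Suc_eq)
    ultimately have "(ws ! ((Suc k + j) mod ?l), ws ! ((Suc k + Suc j) mod ?l)) \<in> E \<union> E\<inverse>"
      by metis
    then show ?case using Suc by (meson Suc_lessD rtrancl.rtrancl_into_rtrancl)
  qed
  have "Suc k + (?l - 1) = k + ?l" using ws(1) by linarith
  then have "(Suc k + (?l - 1)) mod ?l = k" using k(1) by (simp only: mod_add_self2 mod_less)
  then have "(ws ! (Suc k mod ?l), ws ! k) \<in> connected_in E"
    using path[of "?l - 1"] ws(1) by simp
  then show ?thesis using ab connected_in_sym by auto
qed

text \<open>The ends of an added edge lie in different components, so the values on the component of
  \<open>a\<close> can be rescaled by one factor \<open>q\<close> without disturbing the equations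
  on the old edges. With \<open>w\<close> the quotient of two coefficient vectors, \<open>t\<close>
  is the diagonal of a matrix that conjugates one into the other.\<close>

lemma forest_potential:
  fixes w :: "nat \<times> nat \<Rightarrow> 'k::field"
  assumes "finite E" "\<not> has_cycle E" "E \<subseteq> {(a, b). a < b}" "\<And>e. e \<in> E \<Longrightarrow> w e \<noteq> 0"
  shows "\<exists>t. (\<forall>a. t a \<noteq> 0) \<and> (\<forall>(a, b)\<in>E. t a = w (a, b) * t b)"
  using assms
proof (induction E rule: finite_induct)
  case empty
  show ?case by (intro exI[of _ "\<lambda>_. 1"]) auto
next
  case (insert e E)
  obtain a b where e: "e = (a, b)" by fastforce
  have "\<not> has_cycle E" using insert.prems(1) has_cycle_mono by blast
  then have "\<exists>t. (\<forall>a. t a \<noteq> 0) \<and> (\<forall>(a, b)\<in>E. t a = w (a, b) * t b)"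
    using insert.IH insert.prems(2,3) by simp
  then obtain t where t: "\<And>a. t a \<noteq> 0" "\<And>a b. (a, b) \<in> E \<Longrightarrow> t a = w (a, b) * t b"
    by blast
  have "a < b" "\<not> (b, a) \<in> E" using insert.prems(2) e by auto
  then have nc: "(a, b) \<notin> connected_in E"
    using has_cycle_insert_if_connected[of a b E] insert.prems(1) insert.hyps(2) e by auto
  define q where "q = w (a, b) * t b / t a"
  have q: "q \<noteq> 0" using t(1) insert.prems(3)[of e] e by (simp add: q_def)
  define t' where "t' c = (if (a, c) \<in> connected_in E then q * t c else t c)" for c
  have "t' c = w (c, d) * t' d" if "(c, d) \<in> E" for c d
  proof -
    have "(a, c) \<in> connected_in E \<longleftrightarrow> (a, d) \<in> connected_in E"
      using that by (meson UnCI converseI rtrancl.rtrancl_into_rtrancl)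
    then show ?thesis using t(2)[OF that] by (simp add: t'_def)
  qed
  moreover have "t' a = w (a, b) * t' b"
    using nc t(1)[of a] by (simp add: t'_def q_def)
  moreover have "t' c \<noteq> 0" for c using q t(1) by (simp add: t'_def)
  ultimately show ?case using e by (intro exI[of _ t']) auto
qed

text \<open>Every added edge joins two different components, so edges plus components never exceed
  the number of vertices with which the count starts.\<close>

lemma forest_card:
  assumes "finite E" "\<not> has_cycle E" "E \<subseteq> {(a, b). a < b}" "E \<subseteq> W \<times> W" "finite W"
  shows "card E + card ((\<lambda>v. connected_in E `` {v}) ` W) \<le> card W"
  using assms(1-4)
proof (induction E rule: finite_induct)
  case empty
  show ?case using card_image_le[OF assms(5)] by simp
next
  case (insert e E)
  obtain a b where e: "e = (a, b)" by fastforce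
  have "\<not> has_cycle E" using insert.prems(1) has_cycle_mono by blast
  then have IH: "card E + card ((\<lambda>v. connected_in E `` {v}) ` W) \<le> card W"
    using insert.IH insert.prems by auto
  have "a < b" "\<not> (b, a) \<in> E" using insert.prems(2) e by auto
  then have nc: "(a, b) \<notin> connected_in E"
    using has_cycle_insert_if_connected[of a b E] insert.prems(1) insert.hyps(2) e by auto
  \<comment> \<open>\<open>?f\<close> sends a component to the component of the larger graph that
    contains it. It is onto, and not injective because the components of \<open>a\<close> and
    \<open>b\<close> are merged.\<close>
  let ?C = "(\<lambda>v. connected_in E `` {v}) ` W" and ?f = "\<lambda>c. connected_in (insert e E) `` c"
  have f: "?f (connected_in E `` {v}) = connected_in (insert e E) `` {v}" for v
  proof -
    have "connected_in E \<subseteq> connected_in (insert e E)" by (rule rtrancl_mono) auto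
    then show ?thesis
      by (auto intro: rtrancl_trans) 
  qed
  have ab: "a \<in> W" "b \<in> W" using insert.prems(3) e by auto
  have "(a, b) \<in> connected_in (insert e E)" "(b, a) \<in> connected_in (insert e E)" using e by auto
  then have "connected_in (insert e E) `` {a} = connected_in (insert e E) `` {b}"
    by (auto intro: rtrancl_trans)
  moreover have "connected_in E `` {a} \<noteq> connected_in E `` {b}" using nc by blast
  ultimately have "\<not> inj_on ?f ?C"
    using ab f by (metis (no_types, lifting) image_eqI inj_on_def)
  then have "card (?f ` ?C) < card ?C"
    using assms(5) by (metis card_image_le eq_card_imp_inj_on finite_imageI nat_less_le)
  moreover have "?f ` ?C = (\<lambda>v. connected_in (insert e E) `` {v}) ` W"
    by (simp only: image_image f)
  ultimately show ?case using IH insert.hyps by simp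
qed

text \<open>A nonempty vertex set has at least one component. Without vertices there are no edges,
  so the truncated subtraction is harmless.\<close>

corollary forest_card_less:
  assumes "finite E" "\<not> has_cycle E" "E \<subseteq> {(a, b). a < b}" "E \<subseteq> W \<times> W" "finite W"
  shows "card E \<le> card W - 1"
proof (cases "W = {}")
  case False
  then have "card ((\<lambda>v. connected_in E `` {v}) ` W) > 0"
    using assms(5) by (auto simp: card_gt_0_iff)
  then show ?thesis using forest_card[OF assms] by linarith
qed (use assms(4) in auto)

section \<open>Polynomial functions\<close>

text \<open>Euclid's argument: over a finite field, the product of all X - a, plus 1, has positive
  degree and no root.\<close>

lemma infinite_UNIV_alg_closed_field: "infinite (UNIV :: 'k::alg_closed_field set)"
proof
  assume fin: "finite (UNIV :: 'k set)"
  define p :: "'k poly" where "p = (\<Prod>a\<in>UNIV. [:-a, 1:]) + 1"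
  have "degree (\<Prod>a\<in>(UNIV :: 'k set). [:-a, 1:]) = card (UNIV :: 'k set)"
    by (subst degree_prod_eq_sum_degree) auto
  then have "degree p > 0"
    using fin by (simp add: p_def degree_add_eq_left card_gt_0_iff)
  then obtain x where "poly p x = 0" using alg_closed_imp_poly_has_root by blast
  moreover have "poly (\<Prod>a\<in>UNIV. [:-a, 1:]) x = 0"
    using fin by (simp add: poly_prod prod_zero_iff)
  ultimately show False by (simp add: p_def)
qed

lemma poly_funs_sum:
  assumes "\<And>x. x \<in> A \<Longrightarrow> (\<lambda>X. f x X) \<in> poly_funs S"
  shows "(\<lambda>X. \<Sum>x\<in>A. f x X) \<in> poly_funs S"
proof (cases "finite A")
  case True
  then show ?thesis using assms
    by (induction A rule: finite_induct) (auto intro: poly_funs.const poly_funs.add)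
qed (simp add: poly_funs.const)

lemma poly_funs_prod:
  assumes "\<And>x. x \<in> A \<Longrightarrow> (\<lambda>X. f x X) \<in> poly_funs S"
  shows "(\<lambda>X. \<Prod>x\<in>A. f x X) \<in> poly_funs S"
proof (cases "finite A")
  case True
  then show ?thesis using assms
    by (induction A rule: finite_induct) (auto intro: poly_funs.const poly_funs.mult)
qed (simp add: poly_funs.const)

lemma poly_funs_diff:
  assumes "f \<in> poly_funs S" "g \<in> poly_funs S"
  shows "(\<lambda>X. f X - g X) \<in> poly_funs S"
  using poly_funs.add[OF assms(1) poly_funs.mult[OF poly_funs.const[of "-1"] assms(2)]] by simp

lemma poly_funs_det:
  assumes "\<And>i j. i < m \<Longrightarrow> j < m \<Longrightarrow> (\<lambda>X. A X $$ (i, j)) \<in> poly_funs S"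
    and "\<And>X. A X \<in> carrier_mat m m"
  shows "(\<lambda>X. det (A X)) \<in> poly_funs S"
proof -
  have "(\<lambda>X. \<Sum>p\<in>{p. p permutes {0..<m}}. signof p * (\<Prod>i = 0..<m. A X $$ (i, p i))) \<in> poly_funs S"
    using assms(1)
    by (intro poly_funs_sum poly_funs.mult poly_funs.const poly_funs_prod)
      (auto dest: permutes_in_image)
  then show ?thesis unfolding det_def'[OF assms(2)] .
qed

lemma poly_funs_adj_mat:
  assumes "\<And>i j. i < m \<Longrightarrow> j < m \<Longrightarrow> (\<lambda>X. A X $$ (i, j)) \<in> poly_funs S"
    and A: "\<And>X. A X \<in> carrier_mat m m" and "i < m" "j < m"
  shows "(\<lambda>X. adj_mat (A X) $$ (i, j)) \<in> poly_funs S"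
proof -
  have "(\<lambda>X. mat_delete (A X) j i $$ (k, l)) \<in> poly_funs S" if "k < m - 1" "l < m - 1" for k l
    using that assms by (simp add: mat_delete_def carrier_matD[OF A])
  then have "(\<lambda>X. det (mat_delete (A X) j i)) \<in> poly_funs S"
    by (rule poly_funs_det) (use carrier_matD[OF A] in \<open>auto simp: mat_delete_def\<close>)
  then have "(\<lambda>X. (-1)^(j+i) * det (mat_delete (A X) j i)) \<in> poly_funs S"
    by (intro poly_funs.mult poly_funs.const)
  then show ?thesis
    using assms(3,4) by (simp add: adj_mat_def cofactor_def carrier_matD[OF A])
qed

text \<open>Restriction to the line from \<open>a\<close> (at s = 0) to \<open>b\<close> (at s = 1)
  reduces questions about polynomial functions to the finiteness of the roots of a univariate
  polynomial.\<close>

lemma poly_funs_on_line: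
  assumes "f \<in> poly_funs S" "S \<subseteq> {..<n} \<times> {..<n}"
  shows "\<exists>p. \<forall>s. f (unit_comb n S (\<lambda>x. a x + s * (b x - a x))) = poly p s"
  using assms
proof (induction rule: poly_funs.induct)
  case (const c)
  show ?case by (intro exI[of _ "[:c:]"]) simp
next
  case (coord x)
  then show ?case
    by (intro exI[of _ "[:a x, b x - a x:]"]) (auto simp: unit_comb_def)
next
  case (add f g)
  then obtain p q where
    "\<forall>s. f (unit_comb n S (\<lambda>x. a x + s * (b x - a x))) = poly p s"
    "\<forall>s. g (unit_comb n S (\<lambda>x. a x + s * (b x - a x))) = poly q s" by blast
  then show ?case by (intro exI[of _ "p + q"]) simp
next
  case (mult f g)
  then obtain p q where
    "\<forall>s. f (unit_comb n S (\<lambda>x. a x + s * (b x - a x))) = poly p s"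
    "\<forall>s. g (unit_comb n S (\<lambda>x. a x + s * (b x - a x))) = poly q s" by blast
  then show ?case by (intro exI[of _ "p * q"]) simp
qed

text \<open>This is the irreducibility of affine space: two nonempty principal open sets meet. On
  the line from \<open>A\<close> to \<open>B\<close> both restrictions are nonzero polynomials,
  hence so is their product, and the infinite field has a point outside its roots.\<close>

lemma poly_funs_common_nonzero:
  fixes f g :: "'k::alg_closed_field mat \<Rightarrow> 'k"
  assumes "f \<in> poly_funs S" "g \<in> poly_funs S" "S \<subseteq> {..<n} \<times> {..<n}"
    and "A \<in> unit_span n S" "B \<in> unit_span n S" "f A \<noteq> 0" "g B \<noteq> 0"
  shows "\<exists>C \<in> unit_span n S. f C \<noteq> 0 \<and> g C \<noteq> 0"
proof -
  obtain a b where ab: "A = unit_comb n S a" "B = unit_comb n S b"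
    using assms(4,5) by (auto simp: unit_span_def)
  obtain p q where
    p: "\<And>s. f (unit_comb n S (\<lambda>x. a x + s * (b x - a x))) = poly p s" and
    q: "\<And>s. g (unit_comb n S (\<lambda>x. a x + s * (b x - a x))) = poly q s"
    using poly_funs_on_line[OF assms(1,3)] poly_funs_on_line[OF assms(2,3)] by metis
  have "poly p 0 \<noteq> 0" "poly q 1 \<noteq> 0"
    using p[of 0] q[of 1] assms(6,7) ab by auto
  then have "p * q \<noteq> 0" by auto
  then have "finite {s. poly (p * q) s = 0}" by (rule poly_roots_finite)
  then obtain s where "poly (p * q) s \<noteq> 0"
    using infinite_UNIV_alg_closed_field by (metis (mono_tags) UNIV_eq_I mem_Collect_eq)
  then show ?thesis
    using p[of s] q[of s] by (auto simp: unit_span_def intro!: exI[of _ "\<lambda>x. a x + s * (b x - a x)"])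
qed

lemma zariski_dense_nonzero:
  assumes "zariski_dense n S Y" "f \<in> poly_funs S" "Z \<in> unit_span n S" "f Z \<noteq> 0"
  shows "\<exists>y\<in>Y. f y \<noteq> 0"
proof (rule ccontr)
  assume "\<not> ?thesis"
  then have "Y \<subseteq> {X \<in> unit_span n S. \<forall>g\<in>{f}. g X = 0}"
    using assms(1) by (auto simp: zariski_dense_def)
  moreover have "zariski_closed n S {X \<in> unit_span n S. \<forall>g\<in>{f}. g X = 0}"
    unfolding zariski_closed_def using assms(2) by (intro exI[of _ "{f}"]) auto
  ultimately have "{X \<in> unit_span n S. \<forall>g\<in>{f}. g X = 0} = unit_span n S"
    using assms(1) unfolding zariski_dense_def by blast
  then show False using assms(3,4) by blast
qed

section \<open>The algebra and its ideal\<close>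

lemma sorted_wrt_product:
  assumes "sorted_wrt (<) xs" "sorted_wrt (<) ys"
  shows "sorted_wrt (\<lambda>p q. fst p < fst q \<or> fst p = fst q \<and> snd p < snd q)
    (List.product xs (ys :: 'b::order list) :: ('a::order \<times> 'b) list)"
  using assms(1)
proof (induction xs)
  case (Cons x xs)
  have "sorted_wrt (\<lambda>p q. fst p < fst q \<or> fst p = fst q \<and> snd p < snd q) (map (Pair x) ys)"
    using assms(2) by (simp add: sorted_wrt_map)
  then show ?case using Cons by (auto simp: sorted_wrt_append)
qed simp

text \<open>\<open>ones\<close> is listed in lexicographic order, which refines \<turnstile>. Hence
  the matrices in \<open>alg_g D\<close> are upper triangular.\<close>

lemma weak_le_imp_le:
  assumes "weak_le D i j" "i < num_ones D" "j < num_ones D"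
  shows "i \<le> j"
proof (rule ccontr)
  assume "\<not> i \<le> j"
  have "sorted_wrt (\<lambda>p q. fst p < fst q \<or> fst p = fst q \<and> snd p < snd q) (ones D)"
    unfolding ones_def by (intro sorted_wrt_filter sorted_wrt_product) auto
  then have "fst (ones D ! j) < fst (ones D ! i) \<or>
      fst (ones D ! j) = fst (ones D ! i) \<and> snd (ones D ! j) < snd (ones D ! i)"
    using \<open>\<not> i \<le> j\<close> assms(2) by (auto simp: num_ones_def sorted_wrt_iff_nth_less)
  then show False using assms(1) by (auto simp: weak_le_def)
qed

lemma weak_le_refl: "weak_le D i i"
  by (simp add: weak_le_def)

lemma weak_le_trans: "weak_le D i j \<Longrightarrow> weak_le D j k \<Longrightarrow> weak_le D i k"
  by (auto simp: weak_le_def)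

lemma strict_weak_le_trans: "strict_le D i j \<Longrightarrow> weak_le D j k \<Longrightarrow> strict_le D i k"
  by (auto simp: weak_le_def strict_le_def)

lemma weak_strict_le_trans: "weak_le D i j \<Longrightarrow> strict_le D j k \<Longrightarrow> strict_le D i k"
  by (auto simp: weak_le_def strict_le_def)

lemma strict_imp_weak_le: "strict_le D i j \<Longrightarrow> weak_le D i j"
  by (auto simp: weak_le_def strict_le_def)

lemma UU_less: "UU D \<subseteq> {(i, j). i < j}"
proof
  fix x assume x: "x \<in> UU D"
  then have "fst x \<le> snd x" "fst x \<noteq> snd x"
    using weak_le_imp_le[of D "fst x" "snd x"] strict_imp_weak_le
    by (auto simp: UU_def) (auto simp: strict_le_def)
  then show "x \<in> {(i, j). i < j}" by (auto simp: case_prod_beta)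
qed

lemma UU_bound: "UU D \<subseteq> {..<num_ones D} \<times> {..<num_ones D}"
  by (auto simp: UU_def)

lemma VV_bound: "VV D \<subseteq> {..<num_ones D} \<times> {..<num_ones D}"
  by (auto simp: VV_def)

lemma finite_UU: "finite (UU D)"
  using UU_bound finite_subset by blast

lemma finite_VV: "finite (VV D)"
  using VV_bound finite_subset by blast

lemma set_VV_list: "set (VV_list D) = VV D"
  using VV_bound[of D] by (auto simp: VV_list_def)

lemma unit_comb_carrier [simp]: "unit_comb n S c \<in> carrier_mat n n"
  by (simp add: unit_comb_def)

lemma unit_comb_index: "i < n \<Longrightarrow> j < n \<Longrightarrow> unit_comb n S c $$ (i, j) = (if (i, j) \<in> S then c (i, j) else 0)"
  by (simp add: unit_comb_def)

lemma matrix_unit_carrier [simp]: "matrix_unit n v \<in> carrier_mat n n"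
  by (simp add: matrix_unit_def)

lemma matrix_unit_index: "i < n \<Longrightarrow> j < n \<Longrightarrow> matrix_unit n v $$ (i, j) = (if (i, j) = v then 1 else 0)"
  by (simp add: matrix_unit_def)

lemma unit_comb_self:
  assumes "X \<in> unit_span n S"
  shows "unit_comb n S (\<lambda>x. X $$ x) = X"
  using assms by (auto simp: unit_span_def unit_comb_def)

lemma unit_span_iff:
  "X \<in> unit_span n S \<longleftrightarrow> X \<in> carrier_mat n n \<and> (\<forall>i<n. \<forall>j<n. (i, j) \<notin> S \<longrightarrow> X $$ (i, j) = 0)"
proof
  assume X: "X \<in> carrier_mat n n \<and> (\<forall>i<n. \<forall>j<n. (i, j) \<notin> S \<longrightarrow> X $$ (i, j) = 0)"
  then have "X = unit_comb n S (\<lambda>x. X $$ x)"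
    by (intro eq_matI) (auto simp: unit_comb_def)
  then show "X \<in> unit_span n S" by (metis rangeI unit_span_def)
qed (auto simp: unit_span_def unit_comb_def)

lemma unit_span_lincomb:
  assumes "X \<in> unit_span n S" "Y \<in> unit_span n S"
  shows "X + c \<cdot>\<^sub>m Y \<in> unit_span n S"
  using assms by (auto simp: unit_span_iff)

lemma unit_span_diff:
  assumes "X \<in> unit_span n S" "Y \<in> unit_span n S"
  shows "X - Y \<in> unit_span n S"
  using assms by (auto simp: unit_span_iff)

lemma mult_mat_index:
  assumes "X \<in> carrier_mat n n" "Y \<in> carrier_mat n n" "i < n" "j < n"
  shows "(X * Y) $$ (i, j) = (\<Sum>k<n. X $$ (i, k) * Y $$ (k, j))"
  using assms by (simp add: scalar_prod_def atLeast0LessThan)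

text \<open>Closure of the algebra under products and both ideal properties are instances; they
  differ only in the relations that are composed.\<close>

lemma unit_span_mult:
  assumes "X \<in> unit_span n S" "Y \<in> unit_span n T"
    and "\<And>i k j. i < n \<Longrightarrow> k < n \<Longrightarrow> j < n \<Longrightarrow> (i, k) \<in> S \<Longrightarrow> (k, j) \<in> T \<Longrightarrow> (i, j) \<in> R"
  shows "X * Y \<in> unit_span n R"
proof -
  have XY: "X \<in> carrier_mat n n" "Y \<in> carrier_mat n n" using assms(1,2) by (auto simp: unit_span_iff)
  have "(X * Y) $$ (i, j) = 0" if "i < n" "j < n" "(i, j) \<notin> R" for i j
  proof -
    have "X $$ (i, k) * Y $$ (k, j) = 0" if "k < n" for k
    proof -
      have "(i, k) \<notin> S \<or> (k, j) \<notin> T" using assms(3) that \<open>i < n\<close> \<open>j < n\<close> \<open>(i, j) \<notin> R\<close> by blast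
      then show ?thesis using assms(1,2) that \<open>i < n\<close> \<open>j < n\<close> by (auto simp: unit_span_iff)
    qed
    then show ?thesis unfolding mult_mat_index[OF XY that(1,2)] by (simp add: sum.neutral)
  qed
  then show ?thesis using XY by (auto simp: unit_span_iff)
qed

lemma alg_g_carrier: "X \<in> alg_g D \<Longrightarrow> X \<in> carrier_mat (num_ones D) (num_ones D)"
  by (simp add: alg_g_def unit_span_iff)

lemma ideal_u_carrier: "X \<in> ideal_u D \<Longrightarrow> X \<in> carrier_mat (num_ones D) (num_ones D)"
  by (simp add: ideal_u_def unit_span_iff)

lemma alg_g_mult: "X \<in> alg_g D \<Longrightarrow> Y \<in> alg_g D \<Longrightarrow> X * Y \<in> alg_g D"
  unfolding alg_g_def
  by (erule (1) unit_span_mult) (auto simp: VV_def intro: weak_le_trans)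

lemma alg_g_mult_ideal_u: "X \<in> alg_g D \<Longrightarrow> Y \<in> ideal_u D \<Longrightarrow> X * Y \<in> ideal_u D"
  unfolding alg_g_def ideal_u_def
  by (erule (1) unit_span_mult) (auto simp: VV_def UU_def intro: weak_strict_le_trans)

lemma ideal_u_mult_alg_g: "X \<in> ideal_u D \<Longrightarrow> Y \<in> alg_g D \<Longrightarrow> X * Y \<in> ideal_u D"
  unfolding alg_g_def ideal_u_def
  by (erule (1) unit_span_mult) (auto simp: VV_def UU_def intro: strict_weak_le_trans)

lemma one_in_alg_g: "1\<^sub>m (num_ones D) \<in> alg_g D"
  by (auto simp: alg_g_def unit_span_iff VV_def weak_le_refl)

lemma Lmat_in_ideal_u: "Lmat D lam \<in> ideal_u D"
  by (simp add: Lmat_def ideal_u_def unit_span_def)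

lemma Lmat_index: "x \<in> UU D \<Longrightarrow> Lmat D lam $$ x = lam x"
  using UU_bound[of D] by (auto simp: Lmat_def unit_comb_def)

lemma matrix_unit_in_ideal_u: "x \<in> UU D \<Longrightarrow> matrix_unit (num_ones D) x \<in> ideal_u D"
  by (auto simp: ideal_u_def unit_span_iff matrix_unit_def)

text \<open>By triangularity the determinant is the product of the diagonal, so the adjugate yields
  an inverse among all matrices. The real point is that this inverse lies in the algebra
  again.\<close>

lemma alg_g_inverse:
  fixes X :: "'k::field mat"
  assumes X: "X \<in> alg_g D" and diag: "\<And>k. k < num_ones D \<Longrightarrow> X $$ (k, k) \<noteq> 0"
  shows "\<exists>Y\<in>alg_g D. X * Y = 1\<^sub>m (num_ones D) \<and> Y * X = 1\<^sub>m (num_ones D)"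
proof -
  let ?n = "num_ones D"
  have Xc: "X \<in> carrier_mat ?n ?n" using X by (rule alg_g_carrier)
  have supp: "X $$ (i, j) = 0" if "\<not> weak_le D i j" "i < ?n" "j < ?n" for i j
    using X that by (auto simp: alg_g_def unit_span_iff VV_def)
  have "upper_triangular X"
    using Xc supp weak_le_imp_le by (intro upper_triangularI) (metis carrier_matD(1) not_le order.strict_trans)
  then have "det X = prod_list (diag_mat X)"
    using Xc by (rule det_upper_triangular)
  also have "\<dots> \<noteq> 0"
    using diag Xc by (auto simp: prod_list_zero_iff diag_mat_def)
  finally have d: "det X \<noteq> 0" .
  define Y where "Y = (1 / det X) \<cdot>\<^sub>m adj_mat X"
  have Yc: "Y \<in> carrier_mat ?n ?n" using adj_mat(1)[OF Xc] by (simp add: Y_def)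
  have XY: "X * Y = 1\<^sub>m ?n" "Y * X = 1\<^sub>m ?n"
    using adj_mat(2,3)[OF Xc] d
    by (auto simp: Y_def mult_smult_distrib[OF Xc adj_mat(1)[OF Xc]]
        mult_smult_assoc_mat[OF adj_mat(1)[OF Xc] Xc] intro!: eq_matI)
  \<comment> \<open>Induction from the last row upwards. In the entry (k, j) of
    \<open>X * Y\<close>, a term with l \<noteq> k can survive only if k \<turnstile> l; then k < l
    and not l \<turnstile> j, so its factor from \<open>Y\<close> is 0 by induction. Only the
    diagonal term remains.\<close>
  have "Y $$ (k, j) = 0" if "k < ?n" "j < ?n" "\<not> weak_le D k j" for k j
    using that
  proof (induction "?n - k" arbitrary: k rule: less_induct)
    case less
    have "(\<Sum>l<?n. X $$ (k, l) * Y $$ (l, j)) = (\<Sum>l<?n. if l = k then X $$ (k, k) * Y $$ (k, j) else 0)"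
    proof (rule sum.cong)
      fix l assume "l \<in> {..<?n}"
      then have l: "l < ?n" by simp
      show "X $$ (k, l) * Y $$ (l, j) = (if l = k then X $$ (k, k) * Y $$ (k, j) else 0)"
      proof (cases "l \<noteq> k \<and> weak_le D k l")
        case True
        then have "k < l" using weak_le_imp_le[of D k l] less.prems l by simp
        moreover have "\<not> weak_le D l j" using True less.prems weak_le_trans by blast
        ultimately have "Y $$ (l, j) = 0" using less.hyps[of l] less.prems l by simp
        then show ?thesis using True by simp
      qed (use supp less.prems l in auto)
    qed simp
    moreover have "(X * Y) $$ (k, j) = 0"
      using less.prems weak_le_refl XY by auto
    ultimately have "X $$ (k, k) * Y $$ (k, j) = 0"
      unfolding mult_mat_index[OF Xc Yc less.prems(1,2)] using less.prems by simp
    then show ?case using diag less.prems by simp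
  qed
  then have "Y \<in> alg_g D" using Yc by (auto simp: alg_g_def unit_span_iff VV_def)
  then show ?thesis using XY by blast
qed

text \<open>The coefficient matrix of X \<mapsto> X Y - Z X, with row \<open>x\<close> and column
  \<open>v\<close>; for Y = Z = \<open>Lmat D lam\<close> it is the matrix M of the theorem.\<close>

definition bracket_coef :: "nat \<Rightarrow> 'k::field mat \<Rightarrow> 'k mat \<Rightarrow> nat \<times> nat \<Rightarrow> nat \<times> nat \<Rightarrow> 'k" where
  "bracket_coef n Y Z x v = (matrix_unit n v * Y - Z * matrix_unit n v) $$ x"

lemma bracket_unit_comb:
  assumes Y: "Y \<in> carrier_mat n n" and Z: "Z \<in> carrier_mat n n"
    and V: "V \<subseteq> {..<n} \<times> {..<n}" and x: "x \<in> {..<n} \<times> {..<n}"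
  shows "(unit_comb n V y * Y - Z * unit_comb n V y) $$ x = (\<Sum>v\<in>V. bracket_coef n Y Z x v * y v)"
proof -
  obtain i j where ij: "x = (i, j)" "i < n" "j < n" using x by auto
  let ?X = "unit_comb n V y" and ?e = "matrix_unit n :: _ \<Rightarrow> 'a mat"
  have fin: "finite V" using V finite_subset by blast
  have ent: "?X $$ (k, l) = (\<Sum>v\<in>V. ?e v $$ (k, l) * y v)" if "k < n" "l < n" for k l
  proof -
    have "(\<Sum>v\<in>V. ?e v $$ (k, l) * y v) = (\<Sum>v\<in>V. if v = (k, l) then y v else 0)"
      using that by (intro sum.cong) (auto simp: matrix_unit_index)
    then show ?thesis using that fin by (simp add: unit_comb_index)
  qed
  have "(?X * Y) $$ (i, j) = (\<Sum>k<n. \<Sum>v\<in>V. ?e v $$ (i, k) * Y $$ (k, j) * y v)"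
    unfolding mult_mat_index[OF unit_comb_carrier Y ij(2,3)]
    using ij by (intro sum.cong) (auto simp: ent sum_distrib_left sum_distrib_right mult_ac)
  also have "\<dots> = (\<Sum>v\<in>V. (?e v * Y) $$ (i, j) * y v)"
    unfolding mult_mat_index[OF matrix_unit_carrier Y ij(2,3)]
    by (subst sum.swap) (simp add: sum_distrib_right)
  finally have 1: "(?X * Y) $$ (i, j) = (\<Sum>v\<in>V. (?e v * Y) $$ (i, j) * y v)" .
  have "(Z * ?X) $$ (i, j) = (\<Sum>k<n. \<Sum>v\<in>V. Z $$ (i, k) * ?e v $$ (k, j) * y v)"
    unfolding mult_mat_index[OF Z unit_comb_carrier ij(2,3)]
    using ij by (intro sum.cong) (auto simp: ent sum_distrib_left sum_distrib_right mult_ac)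
  also have "\<dots> = (\<Sum>v\<in>V. (Z * ?e v) $$ (i, j) * y v)"
    unfolding mult_mat_index[OF Z matrix_unit_carrier ij(2,3)]
    by (subst sum.swap) (simp add: sum_distrib_right)
  finally have 2: "(Z * ?X) $$ (i, j) = (\<Sum>v\<in>V. (Z * ?e v) $$ (i, j) * y v)" .
  have "dim_row Z = n" "dim_col (?e v) = n" "dim_col ?X = n" for v
    using Z by (auto simp: matrix_unit_def unit_comb_def)
  then show ?thesis
    using 1 2 ij by (simp add: bracket_coef_def sum_subtractf left_diff_distrib)
qed

section \<open>Truncated commutator maps\<close>

definition polynomial_family :: "nat \<Rightarrow> (nat \<times> nat) set \<Rightarrow> ('k::field mat \<Rightarrow> 'k mat) \<Rightarrow> bool" where
  "polynomial_family n S A \<longleftrightarrow>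
     (\<forall>T. A T \<in> carrier_mat n n) \<and> (\<forall>i<n. \<forall>j<n. (\<lambda>T. A T $$ (i, j)) \<in> poly_funs S)"

lemma polynomial_family_const: "M \<in> carrier_mat n n \<Longrightarrow> polynomial_family n S (\<lambda>_. M)"
  by (simp add: polynomial_family_def poly_funs.const)

text \<open>Only the entries at positions in \<open>S\<close> count as coordinates, so the identity
  is not a polynomial family. Projection to the span is one, and it fixes the points of the
  span.\<close>

lemma polynomial_family_proj: "polynomial_family n S (\<lambda>T. unit_comb n S (\<lambda>x. T $$ x))"
  unfolding polynomial_family_def
proof (intro conjI allI impI)
  fix i j assume ij: "i < n" "j < n"
  show "(\<lambda>T. unit_comb n S (\<lambda>x. T $$ x) $$ (i, j)) \<in> poly_funs S"
    using ij by (cases "(i, j) \<in> S") (auto simp: unit_comb_index intro: poly_funs.const poly_funs.coord)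
qed auto

lemma poly_funs_bracket_coef:
  assumes A: "polynomial_family n S A" and B: "polynomial_family n S B" and "x \<in> {..<n} \<times> {..<n}"
  shows "(\<lambda>T. bracket_coef n (A T) (B T) x v) \<in> poly_funs S"
proof -
  obtain i j where ij: "x = (i, j)" "i < n" "j < n" using assms(3) by auto
  have Ac: "\<And>T. A T \<in> carrier_mat n n" and Bc: "\<And>T. B T \<in> carrier_mat n n"
    using A B by (auto simp: polynomial_family_def)
  have "bracket_coef n (A T) (B T) x v =
      (\<Sum>k<n. matrix_unit n v $$ (i, k) * A T $$ (k, j)) - (\<Sum>k<n. B T $$ (i, k) * matrix_unit n v $$ (k, j))" for T
  proof -
    have d: "dim_row (B T) = n" "dim_col (matrix_unit n v :: 'a mat) = n"
      using Bc[of T] by (auto simp: matrix_unit_def)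
    have "bracket_coef n (A T) (B T) x v = (matrix_unit n v * A T) $$ (i, j) - (B T * matrix_unit n v) $$ (i, j)"
      using ij d unfolding bracket_coef_def by (simp only: index_minus_mat(1) index_mult_mat(2,3))
    then show ?thesis
      unfolding mult_mat_index[OF matrix_unit_carrier Ac ij(2,3)] mult_mat_index[OF Bc matrix_unit_carrier ij(2,3)] .
  qed
  moreover have "(\<lambda>T. (\<Sum>k<n. matrix_unit n v $$ (i, k) * A T $$ (k, j))
      - (\<Sum>k<n. B T $$ (i, k) * matrix_unit n v $$ (k, j))) \<in> poly_funs S"
    using A B ij unfolding polynomial_family_def
    by (intro poly_funs_diff poly_funs_sum poly_funs.mult poly_funs.const) auto
  ultimately show ?thesis by simp
qed

locale adapted_order =
  fixes D :: "nat mat" and xs :: "(nat \<times> nat) list"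
  assumes adapted: "adapted_enumeration D xs"
begin

abbreviation n :: nat where "n \<equiv> num_ones D"

lemma set_xs: "set xs = UU D" and distinct_xs: "distinct xs"
  using adapted by (auto simp: adapted_enumeration_def)

lemma xs_UU: "r < length xs \<Longrightarrow> xs ! r \<in> UU D"
  using set_xs nth_mem by blast

lemma xs_bound: "r < length xs \<Longrightarrow> xs ! r \<in> {..<n} \<times> {..<n}"
  using xs_UU UU_bound by blast

lemma xs_eq_iff: "r < length xs \<Longrightarrow> s < length xs \<Longrightarrow> xs ! r = xs ! s \<longleftrightarrow> r = s"
  using distinct_xs by (rule nth_eq_iff_index_eq)

lemma contained_index:
  assumes "r < length xs" "x \<in> UU D" "contained D x (xs ! r)"
  obtains s where "s \<le> r" "x = xs ! s"
proof -
  obtain s where "s < length xs" "x = xs ! s"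
    using assms(2) set_xs by (metis in_set_conv_nth)
  then show ?thesis using that assms adapted by (auto simp: adapted_enumeration_def)
qed

text \<open>
  Since the enumeration is adapted, \<open>agree m\<close> is equality modulo a sub-bimodule of $\mathfrak u$.
\<close>

definition agree :: "nat \<Rightarrow> 'k::field mat \<Rightarrow> 'k mat \<Rightarrow> bool" where
  "agree m A B \<longleftrightarrow> (\<forall>r<m. A $$ (xs ! r) = B $$ (xs ! r))"

text \<open>The case Y = Z = L(\<lambda>) expresses independence of the first \<open>m\<close> rows;
  the general case serves to compare the orbits of Y and Z.\<close>

definition spans :: "nat \<Rightarrow> 'k::field mat \<Rightarrow> 'k mat \<Rightarrow> bool" where
  "spans m Y Z \<longleftrightarrow> (\<forall>C\<in>ideal_u D. \<exists>X\<in>alg_g D. agree m (X * Y - Z * X) C)"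

lemma agree_refl: "agree m A A"
  and agree_sym: "agree m A B \<Longrightarrow> agree m B A"
  and agree_trans: "agree m A B \<Longrightarrow> agree m B C \<Longrightarrow> agree m A C"
  and agree_Suc: "agree (Suc m) A B \<longleftrightarrow> agree m A B \<and> A $$ (xs ! m) = B $$ (xs ! m)"
  by (auto simp: agree_def less_Suc_eq)

lemma agree_all:
  assumes "A \<in> ideal_u D" "B \<in> ideal_u D" "agree (length xs) A B"
  shows "A = B"
proof (rule eq_matI)
  fix i j assume "i < dim_row B" "j < dim_col B"
  then have ij: "i < n" "j < n" using assms(2) by (auto simp: ideal_u_def unit_span_iff)
  show "A $$ (i, j) = B $$ (i, j)"
  proof (cases "(i, j) \<in> UU D")
    case True
    then show ?thesis using assms(3) set_xs unfolding agree_def by (metis in_set_conv_nth)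
  next
    case False
    then show ?thesis using assms(1,2) ij by (auto simp: ideal_u_def unit_span_iff)
  qed
qed (use assms in \<open>auto simp: ideal_u_def unit_span_iff\<close>)

text \<open>The entry (i, j) of X A uses A only at positions (k, j) with i \<turnstile> k. These are
  contained in (i, j), so an adapted enumeration lists them no later than (i, j). Right
  multiplication is the mirror image, with positions (i, k) and k \<turnstile> j.\<close>

lemma agree_mult_left:
  assumes m: "m \<le> length xs" and X: "X \<in> alg_g D" and A: "A \<in> ideal_u D" and B: "B \<in> ideal_u D"
    and AB: "agree m A B"
  shows "agree m (X * A) (X * B)"
  unfolding agree_def
proof (intro allI impI)
  fix r assume r: "r < m"
  obtain i j where ij: "xs ! r = (i, j)" "i < n" "j < n" using xs_bound[of r] r m by auto
  have "X $$ (i, k) * A $$ (k, j) = X $$ (i, k) * B $$ (k, j)" if k: "k < n" for k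
  proof (cases "(i, k) \<in> VV D \<and> (k, j) \<in> UU D")
    case True
    then have "contained D (k, j) (xs ! r)" using ij by (auto simp: contained_def VV_def weak_le_refl)
    then obtain s where "s \<le> r" "(k, j) = xs ! s" using contained_index[of r "(k, j)"] True r m by auto
    then show ?thesis using AB r by (auto simp: agree_def)
  next
    case False
    then show ?thesis using X A B ij k by (auto simp: alg_g_def ideal_u_def unit_span_iff)
  qed
  then show "(X * A) $$ (xs ! r) = (X * B) $$ (xs ! r)"
    using ij mult_mat_index[OF alg_g_carrier[OF X] ideal_u_carrier[OF A] ij(2,3)]
      mult_mat_index[OF alg_g_carrier[OF X] ideal_u_carrier[OF B] ij(2,3)]
    by (auto intro!: sum.cong)
qed

lemma agree_mult_right:
  assumes m: "m \<le> length xs" and X: "X \<in> alg_g D" and A: "A \<in> ideal_u D" and B: "B \<in> ideal_u D"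
    and AB: "agree m A B"
  shows "agree m (A * X) (B * X)"
  unfolding agree_def
proof (intro allI impI)
  fix r assume r: "r < m"
  obtain i j where ij: "xs ! r = (i, j)" "i < n" "j < n" using xs_bound[of r] r m by auto
  have "A $$ (i, k) * X $$ (k, j) = B $$ (i, k) * X $$ (k, j)" if k: "k < n" for k
  proof (cases "(k, j) \<in> VV D \<and> (i, k) \<in> UU D")
    case True
    then have "contained D (i, k) (xs ! r)" using ij by (auto simp: contained_def VV_def weak_le_refl)
    then obtain s where "s \<le> r" "(i, k) = xs ! s" using contained_index[of r "(i, k)"] True r m by auto
    then show ?thesis using AB r by (auto simp: agree_def)
  next
    case False
    then show ?thesis using X A B ij k by (auto simp: alg_g_def ideal_u_def unit_span_iff)
  qed
  then show "(A * X) $$ (xs ! r) = (B * X) $$ (xs ! r)"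
    using ij mult_mat_index[OF ideal_u_carrier[OF A] alg_g_carrier[OF X] ij(2,3)]
      mult_mat_index[OF ideal_u_carrier[OF B] alg_g_carrier[OF X] ij(2,3)]
    by (auto intro!: sum.cong)
qed

lemma diff_index:
  assumes "A \<in> carrier_mat n n" "B \<in> carrier_mat n n" "r < length xs"
  shows "(A - B) $$ (xs ! r) = A $$ (xs ! r) - B $$ (xs ! r)"
  using assms xs_bound[OF assms(3)] by auto

lemma agree_diff:
  assumes "m \<le> length xs" "A \<in> carrier_mat n n" "B \<in> carrier_mat n n" "A' \<in> carrier_mat n n" "B' \<in> carrier_mat n n"
    "agree m A A'" "agree m B B'"
  shows "agree m (A - B) (A' - B')"
  using assms by (auto simp: agree_def diff_index)

lemma bracket_in_ideal_u:
  assumes "X \<in> alg_g D" "Y \<in> ideal_u D" "Z \<in> ideal_u D"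
  shows "X * Y - Z * X \<in> ideal_u D"
  using assms alg_g_mult_ideal_u ideal_u_mult_alg_g unit_span_diff unfolding ideal_u_def by blast

lemma agree_bracket:
  assumes m: "m \<le> length xs" and X: "X \<in> alg_g D" and "Y \<in> ideal_u D" "Y' \<in> ideal_u D" "Z \<in> ideal_u D" "Z' \<in> ideal_u D"
    and "agree m Y Y'" "agree m Z Z'"
  shows "agree m (X * Y - Z * X) (X * Y' - Z' * X)"
proof -
  have "agree m (X * Y) (X * Y')" using assms by (intro agree_mult_left)
  moreover have "agree m (Z * X) (Z' * X)" using assms by (intro agree_mult_right)
  ultimately show ?thesis
    using assms by (intro agree_diff) (auto intro: ideal_u_carrier alg_g_mult_ideal_u ideal_u_mult_alg_g)
qed

lemma spans_agree:
  assumes "m \<le> length xs" "Y \<in> ideal_u D" "Y' \<in> ideal_u D" "Z \<in> ideal_u D" "Z' \<in> ideal_u D"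
    and "agree m Y Y'" "agree m Z Z'" "spans m Y Z"
  shows "spans m Y' Z'"
  unfolding spans_def
proof
  fix C :: "'a mat" assume "C \<in> ideal_u D"
  then obtain X where X: "X \<in> alg_g D" "agree m (X * Y - Z * X) C" using assms(8) by (auto simp: spans_def)
  then show "\<exists>X\<in>alg_g D. agree m (X * Y' - Z' * X) C"
    using agree_bracket[OF assms(1) X(1) assms(2-7)] agree_sym agree_trans by blast
qed

text \<open>The substitution X \<mapsto> h X g' intertwines the two maps: h (X Y - Z X) g' is the
  bracket of h X g' formed with g Y g' and h Z h'. Solving for h' C g before conjugation therefore
  solves for C afterwards.\<close>

lemma spans_conj:
  assumes m: "m \<le> length xs" and Y: "Y \<in> ideal_u D" and Z: "Z \<in> ideal_u D"
    and g: "g \<in> alg_g D" "g' \<in> alg_g D" "g * g' = 1\<^sub>m n" "g' * g = 1\<^sub>m n"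
    and h: "h \<in> alg_g D" "h' \<in> alg_g D" "h * h' = 1\<^sub>m n" "h' * h = 1\<^sub>m n"
    and sp: "spans m Y Z"
  shows "spans m (g * Y * g') (h * Z * h')"
  unfolding spans_def
proof
  fix C :: "'a mat" assume C: "C \<in> ideal_u D"
  note c = alg_g_carrier[OF g(1)] alg_g_carrier[OF g(2)] alg_g_carrier[OF h(1)] alg_g_carrier[OF h(2)]
    ideal_u_carrier[OF Y] ideal_u_carrier[OF Z] ideal_u_carrier[OF C]
  have hC: "h' * C * g \<in> ideal_u D"
    by (rule ideal_u_mult_alg_g[OF alg_g_mult_ideal_u[OF h(2) C] g(1)])
  then obtain X where X: "X \<in> alg_g D" "agree m (X * Y - Z * X) (h' * C * g)"
    using sp by (auto simp: spans_def)
  have Xc: "X \<in> carrier_mat n n" using X alg_g_carrier by blast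
  have b: "X * Y - Z * X \<in> ideal_u D" using X(1) Y Z by (rule bracket_in_ideal_u)
  have "agree m (h * (X * Y - Z * X) * g') (h * (h' * C * g) * g')"
    by (rule agree_mult_right[OF m g(2) alg_g_mult_ideal_u[OF h(1) b] alg_g_mult_ideal_u[OF h(1) hC]
        agree_mult_left[OF m h(1) b hC X(2)]])
  moreover have "h * (h' * C * g) * g' = C"
  proof -
    have "h * (h' * C * g) * g' = (h * h') * C * (g * g')"
      using c by (simp add: assoc_mult_mat[of _ n n _ n _ n])
    then show ?thesis using c g h by simp
  qed
  moreover have "h * (X * Y - Z * X) * g' = (h * X * g') * (g * Y * g') - (h * Z * h') * (h * X * g')"
  proof -
    have "(h * X * g') * (g * Y * g') = h * X * (g' * g) * Y * g'"
      using c Xc by (simp add: assoc_mult_mat[of _ n n _ n _ n])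
    moreover have "(h * Z * h') * (h * X * g') = h * Z * (h' * h) * X * g'"
      using c Xc by (simp add: assoc_mult_mat[of _ n n _ n _ n])
    moreover have "h * (X * Y - Z * X) * g' = h * X * Y * g' - h * Z * X * g'"
    proof -
      have "h * (X * Y - Z * X) = h * (X * Y) - h * (Z * X)"
        using c Xc by (intro mult_minus_distrib_mat[of _ n n _ n]) auto
      moreover have "(h * (X * Y) - h * (Z * X)) * g' = h * (X * Y) * g' - h * (Z * X) * g'"
        using c Xc by (intro minus_mult_distrib_mat[of _ n n _ _ n]) auto
      ultimately show ?thesis using c Xc by (simp add: assoc_mult_mat[of _ n n _ n _ n])
    qed
    ultimately show ?thesis using c Xc g h by simp
  qed
  ultimately have "agree m ((h * X * g') * (g * Y * g') - (h * Z * h') * (h * X * g')) C" by simp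
  moreover have "h * X * g' \<in> alg_g D" using X g h alg_g_mult by blast
  ultimately show "\<exists>X\<in>alg_g D. agree m (X * (g * Y * g') - (h * Z * h') * X) C" by blast
qed

text \<open>Solutions for the matrix units at \<open>xs ! s\<close> are the columns of a right
  inverse, and these solve for any C by superposition.\<close>

lemma spans_iff_right_inverse:
  assumes m: "m \<le> length xs" and Y: "Y \<in> carrier_mat n n" and Z: "Z \<in> carrier_mat n n"
  shows "spans m Y Z \<longleftrightarrow>
    (\<exists>y. \<forall>r<m. \<forall>s<m. (\<Sum>v\<in>VV D. bracket_coef n Y Z (xs ! r) v * y s v) = (if r = s then 1 else 0))"
    (is "_ \<longleftrightarrow> ?R")
proof
  assume sp: "spans m Y Z"
  have "\<exists>y. \<forall>r<m. (\<Sum>v\<in>VV D. bracket_coef n Y Z (xs ! r) v * y v) = (if r = s then 1 else 0)" if "s < m" for s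
  proof -
    have "(matrix_unit n (xs ! s) :: 'a mat) \<in> ideal_u D" using that m by (intro matrix_unit_in_ideal_u xs_UU) simp
    then obtain X where X: "X \<in> alg_g D" "agree m (X * Y - Z * X) (matrix_unit n (xs ! s))"
      using sp by (auto simp: spans_def)
    obtain y where y: "X = unit_comb n (VV D) y" using X(1) by (auto simp: alg_g_def unit_span_def)
    have "(\<Sum>v\<in>VV D. bracket_coef n Y Z (xs ! r) v * y v) = (if r = s then 1 else 0)" if r: "r < m" for r
    proof -
      have "(\<Sum>v\<in>VV D. bracket_coef n Y Z (xs ! r) v * y v) = matrix_unit n (xs ! s) $$ (xs ! r)"
        using bracket_unit_comb[OF Y Z VV_bound xs_bound, of r y] X(2) y r m by (simp add: agree_def)
      also have "\<dots> = (if r = s then 1 else 0)"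
        using r m \<open>s < m\<close> xs_bound[of r] xs_eq_iff[of r s] by (auto simp: matrix_unit_def)
      finally show ?thesis .
    qed
    then show ?thesis by blast
  qed
  then show ?R by metis
next
  assume ?R
  then obtain y where y: "\<And>r s. r < m \<Longrightarrow> s < m \<Longrightarrow>
      (\<Sum>v\<in>VV D. bracket_coef n Y Z (xs ! r) v * y s v) = (if r = s then 1 else 0)" by blast
  show "spans m Y Z"
    unfolding spans_def
  proof
    fix C :: "'a mat" assume C: "C \<in> ideal_u D"
    let ?c = "\<lambda>v. \<Sum>s<m. y s v * C $$ (xs ! s)"
    have "(unit_comb n (VV D) ?c * Y - Z * unit_comb n (VV D) ?c) $$ (xs ! r) = C $$ (xs ! r)" if r: "r < m" for r
    proof -
      have "(unit_comb n (VV D) ?c * Y - Z * unit_comb n (VV D) ?c) $$ (xs ! r) =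
          (\<Sum>v\<in>VV D. \<Sum>s<m. bracket_coef n Y Z (xs ! r) v * y s v * C $$ (xs ! s))"
        using bracket_unit_comb[OF Y Z VV_bound xs_bound, of r] r m by (simp add: sum_distrib_left mult.assoc)
      also have "\<dots> = (\<Sum>s<m. (\<Sum>v\<in>VV D. bracket_coef n Y Z (xs ! r) v * y s v) * C $$ (xs ! s))"
        by (subst sum.swap) (simp add: sum_distrib_right)
      also have "\<dots> = C $$ (xs ! r)"
        using r y by (simp add: if_distrib[of "\<lambda>x. x * _"] cong: if_cong)
      finally show ?thesis .
    qed
    then show "\<exists>X\<in>alg_g D. agree m (X * Y - Z * X) C"
      by (intro bexI[of _ "unit_comb n (VV D) ?c"]) (auto simp: agree_def alg_g_def unit_span_def)
  qed
qed

lemma rows_dependent_iff: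
  assumes m: "m \<le> length xs"
  shows "rows_dependent (Mmat D xs lam) m \<longleftrightarrow> \<not> spans m (Lmat D lam) (Lmat D lam)"
proof -
  have L: "Lmat D lam \<in> carrier_mat n n" using Lmat_in_ideal_u ideal_u_carrier by blast
  have ent: "Mmat D xs lam $$ (r, l) = bracket_coef n (Lmat D lam) (Lmat D lam) (xs ! r) (VV_list D ! l)"
    if "r < m" "l < length (VV_list D)" for r l
    using that m by (simp add: Mmat_def bracket_coef_def commutator_def)
  have "(\<forall>l<dim_col (Mmat D xs lam). (\<Sum>r<m. c r * Mmat D xs lam $$ (r, l)) = 0) \<longleftrightarrow>
      (\<forall>v\<in>VV D. (\<Sum>r<m. c r * bracket_coef n (Lmat D lam) (Lmat D lam) (xs ! r) v) = 0)" for c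
  proof -
    have "(\<forall>l<dim_col (Mmat D xs lam). (\<Sum>r<m. c r * Mmat D xs lam $$ (r, l)) = 0) \<longleftrightarrow>
        (\<forall>l<length (VV_list D). (\<Sum>r<m. c r * bracket_coef n (Lmat D lam) (Lmat D lam) (xs ! r) (VV_list D ! l)) = 0)"
      using ent by (simp add: Mmat_def)
    also have "\<dots> \<longleftrightarrow> (\<forall>v\<in>set (VV_list D). (\<Sum>r<m. c r * bracket_coef n (Lmat D lam) (Lmat D lam) (xs ! r) v) = 0)"
      by (simp add: all_set_conv_all_nth)
    finally show ?thesis by (simp add: set_VV_list)
  qed
  then show ?thesis
    unfolding rows_dependent_def spans_iff_right_inverse[OF m L L]
      right_inverse_iff_independent[OF finite_VV] by auto
qed

lemma bracket_lincomb:
  fixes X X' Y Z :: "'k::field mat"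
  assumes "X \<in> carrier_mat n n" "X' \<in> carrier_mat n n" "Y \<in> carrier_mat n n" "Z \<in> carrier_mat n n" "r < length xs"
  shows "((X' + s \<cdot>\<^sub>m X) * Y - Z * (X' + s \<cdot>\<^sub>m X)) $$ (xs ! r) =
    (X' * Y - Z * X') $$ (xs ! r) + s * (X * Y - Z * X) $$ (xs ! r)"
proof -
  obtain i j where ij: "xs ! r = (i, j)" "i < n" "j < n" using xs_bound[OF assms(5)] by auto
  have "(X' + s \<cdot>\<^sub>m X) * Y = X' * Y + s \<cdot>\<^sub>m (X * Y)"
    using assms by (simp add: add_mult_distrib_mat[of _ n n] mult_smult_assoc_mat[OF assms(1,3)])
  moreover have "Z * (X' + s \<cdot>\<^sub>m X) = Z * X' + s \<cdot>\<^sub>m (Z * X)"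
    using assms by (simp add: mult_add_distrib_mat[of _ n n] mult_smult_distrib[OF assms(4,1)])
  ultimately show ?thesis
    using assms ij carrier_matD[OF assms(1)] carrier_matD[OF assms(2)] carrier_matD[OF assms(3)] carrier_matD[OF assms(4)]
    by (simp add: algebra_simps del: index_mult_mat(1))
qed

text \<open>Among the first m + 1 coordinates of the bracket, X affects only the last, so a multiple
  of X corrects a solution there. Read backwards: if \<open>m\<close> coordinates are reached but
  not m + 1, then coordinate \<open>m\<close> of the bracket vanishes for every X for which the
  first \<open>m\<close> do.\<close>

lemma spans_SucI:
  assumes m: "m < length xs" and Y: "Y \<in> ideal_u D" and Z: "Z \<in> ideal_u D" and sp: "spans m Y Z"
    and X: "X \<in> alg_g D" "agree m (X * Y) (Z * X)" "(X * Y - Z * X) $$ (xs ! m) \<noteq> 0"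
  shows "spans (Suc m) Y Z"
  unfolding spans_def
proof
  fix C :: "'a mat" assume "C \<in> ideal_u D"
  then obtain X' where X': "X' \<in> alg_g D" "agree m (X' * Y - Z * X') C" using sp by (auto simp: spans_def)
  note c = alg_g_carrier[OF X(1)] alg_g_carrier[OF X'(1)] ideal_u_carrier[OF Y] ideal_u_carrier[OF Z]
  define s where "s = (C $$ (xs ! m) - (X' * Y - Z * X') $$ (xs ! m)) / (X * Y - Z * X) $$ (xs ! m)"
  let ?X = "X' + s \<cdot>\<^sub>m X"
  have "(?X * Y - Z * ?X) $$ (xs ! m) = C $$ (xs ! m)"
    unfolding bracket_lincomb[OF c m] using X(3) by (simp add: s_def)
  moreover have "(?X * Y - Z * ?X) $$ (xs ! r) = C $$ (xs ! r)" if "r < m" for r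
  proof -
    have r: "r < length xs" using that m by simp
    have "(X * Y - Z * X) $$ (xs ! r) = 0"
      using X(2) that c diff_index[OF _ _ r, of "X * Y" "Z * X"] by (simp add: agree_def)
    then show ?thesis
      unfolding bracket_lincomb[OF c r] using X'(2) that by (simp add: agree_def)
  qed
  moreover have "?X \<in> alg_g D"
    using X X' unfolding alg_g_def by (intro unit_span_lincomb)
  ultimately show "\<exists>X\<in>alg_g D. agree (Suc m) (X * Y - Z * X) C"
    by (intro bexI[of _ ?X]) (auto simp: agree_def less_Suc_eq)
qed

section \<open>Openness of surjectivity and of truncated orbits\<close>

definition gram :: "nat \<Rightarrow> (nat \<Rightarrow> nat \<times> nat \<Rightarrow> 'k) \<Rightarrow> 'k::field mat \<Rightarrow> 'k mat \<Rightarrow> 'k mat" where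
  "gram m y Y Z = mat m m (\<lambda>(r, s). \<Sum>v\<in>VV D. bracket_coef n Y Z (xs ! r) v * y s v)"

lemma gram_carrier [simp]: "gram m y Y Z \<in> carrier_mat m m"
  by (simp add: gram_def)

lemma poly_funs_gram:
  assumes "m \<le> length xs" "polynomial_family n (UU D) A" "polynomial_family n (UU D) B" "r < m" "s < m"
  shows "(\<lambda>T. gram m y (A T) (B T) $$ (r, s)) \<in> poly_funs (UU D)"
proof -
  have "(\<lambda>T. \<Sum>v\<in>VV D. bracket_coef n (A T) (B T) (xs ! r) v * y s v) \<in> poly_funs (UU D)"
    using assms xs_bound[of r]
    by (intro poly_funs_sum poly_funs.mult poly_funs.const poly_funs_bracket_coef) auto
  then show ?thesis using assms by (simp add: gram_def)
qed

lemma gram_combination: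
  assumes "r < m"
  shows "(\<Sum>v\<in>VV D. bracket_coef n Y Z (xs ! r) v * (\<Sum>p<m. y p v * e p)) = (\<Sum>p<m. gram m y Y Z $$ (r, p) * e p)"
proof -
  have "(\<Sum>v\<in>VV D. bracket_coef n Y Z (xs ! r) v * (\<Sum>p<m. y p v * e p)) =
      (\<Sum>p<m. \<Sum>v\<in>VV D. bracket_coef n Y Z (xs ! r) v * y p v * e p)"
    by (subst sum.swap) (simp add: sum_distrib_left mult.assoc)
  also have "\<dots> = (\<Sum>p<m. gram m y Y Z $$ (r, p) * e p)"
    using assms by (intro sum.cong) (auto simp: gram_def sum_distrib_right)
  finally show ?thesis .
qed

lemma gram_adj_mat:
  assumes "r < m" "s < m"
  shows "(\<Sum>p<m. gram m y Y Z $$ (r, p) * adj_mat (gram m y Y Z) $$ (p, s)) =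
    (if r = s then det (gram m y Y Z) else 0)"
proof -
  note adj = adj_mat[OF gram_carrier, of m y Y Z]
  have "(\<Sum>p<m. gram m y Y Z $$ (r, p) * adj_mat (gram m y Y Z) $$ (p, s)) =
      (gram m y Y Z * adj_mat (gram m y Y Z)) $$ (r, s)"
    by (rule mult_mat_index[OF gram_carrier adj(1) assms, symmetric])
  then show ?thesis unfolding adj(2) using assms by simp
qed

lemma spans_gram:
  assumes m: "m \<le> length xs" and "Y \<in> carrier_mat n n" "Z \<in> carrier_mat n n" "spans m Y Z"
  obtains y where "gram m y Y Z = 1\<^sub>m m"
proof -
  obtain y where "\<And>r s. r < m \<Longrightarrow> s < m \<Longrightarrow> (\<Sum>v\<in>VV D. bracket_coef n Y Z (xs ! r) v * y s v) = (if r = s then 1 else 0)"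
    using spans_iff_right_inverse[OF assms(1-3)] assms(4) by blast
  then have "gram m y Y Z = 1\<^sub>m m" by (intro eq_matI) (auto simp: gram_def)
  then show ?thesis by (rule that)
qed

text \<open>\<open>gram\<close> multiplies the coefficient matrix by a fixed candidate
  \<open>y\<close> for a right inverse. If the product is invertible, \<open>y\<close> times its
  inverse, the adjugate over the determinant, is a true right inverse. Keeping \<open>y\<close>
  fixed makes this one polynomial condition on Y and Z, without the choice of a minor.\<close>

lemma spans_if_det_gram:
  assumes "m \<le> length xs" "Y \<in> carrier_mat n n" "Z \<in> carrier_mat n n" "det (gram m y Y Z) \<noteq> 0"
  shows "spans m Y Z"
  unfolding spans_iff_right_inverse[OF assms(1-3)]
proof (intro exI allI impI)
  fix r s assume rs: "r < m" "s < m"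
  let ?e = "\<lambda>p. adj_mat (gram m y Y Z) $$ (p, s) / det (gram m y Y Z)"
  have "(\<Sum>v\<in>VV D. bracket_coef n Y Z (xs ! r) v * (\<Sum>p<m. y p v * ?e p)) =
      (\<Sum>p<m. gram m y Y Z $$ (r, p) * adj_mat (gram m y Y Z) $$ (p, s)) / det (gram m y Y Z)"
    unfolding gram_combination[OF rs(1)] by (simp add: sum_divide_distrib)
  also have "\<dots> = (if r = s then 1 else 0)"
    unfolding gram_adj_mat[OF rs] using assms(4) by simp
  finally show "(\<Sum>v\<in>VV D. bracket_coef n Y Z (xs ! r) v * (\<Sum>p<m. y p v * ?e p)) = (if r = s then 1 else 0)" .
qed

text \<open>With \<open>y\<close> a right inverse at the given point, the determinant of
  \<open>gram\<close> is 1 there and polynomial in T. Using families allows one argument to stay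
  constant while the other varies.\<close>

lemma spans_open:
  assumes m: "m \<le> length xs" and A: "polynomial_family n (UU D) A" and B: "polynomial_family n (UU D) B"
    and sp: "spans m (A Z) (B Z)"
  shows "\<exists>f\<in>poly_funs (UU D). f Z \<noteq> 0 \<and> (\<forall>T. f T \<noteq> 0 \<longrightarrow> spans m (A T) (B T))"
proof -
  have c: "A T \<in> carrier_mat n n" "B T \<in> carrier_mat n n" for T
    using A B by (auto simp: polynomial_family_def)
  obtain y where y: "gram m y (A Z) (B Z) = 1\<^sub>m m" using spans_gram[OF m c sp] .
  have "(\<lambda>T. det (gram m y (A T) (B T))) \<in> poly_funs (UU D)"
    using poly_funs_gram[OF m A B] by (intro poly_funs_det[where m = m]) auto
  then show ?thesis
    using y spans_if_det_gram[OF m c] by (intro bexI[of _ "\<lambda>T. det (gram m y (A T) (B T))"]) auto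
qed

abbreviation proj_u :: "'k::field mat \<Rightarrow> 'k mat" where
  "proj_u T \<equiv> unit_comb n (UU D) (\<lambda>x. T $$ x)"

lemma proj_u_id: "T \<in> ideal_u D \<Longrightarrow> proj_u T = T"
  unfolding ideal_u_def by (rule unit_comb_self)

text \<open>
  By Cramer's rule the equation $X L = T X$ modulo the coordinates from \<open>m\<close> on has a solution \<open>X\<close>
  that depends polynomially on \<open>T\<close> and is the identity for $T = L$; it is invertible as soon as its
  diagonal entries do not vanish.
\<close>

lemma spans_conj_open:
  fixes L :: "'k::field mat"
  assumes m: "m \<le> length xs" and L: "L \<in> ideal_u D" and sp: "spans m L L"
  shows "\<exists>f\<in>poly_funs (UU D). f L \<noteq> 0 \<and> (\<forall>T\<in>ideal_u D. f T \<noteq> 0 \<longrightarrow>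
    (\<exists>g\<in>alg_g D. \<exists>h\<in>alg_g D. g * h = 1\<^sub>m n \<and> h * g = 1\<^sub>m n \<and> agree m (g * L) (T * g)))"
proof -
  have Lc: "L \<in> carrier_mat n n" using L by (rule ideal_u_carrier)
  obtain y where y: "gram m y L L = 1\<^sub>m m" using spans_gram[OF m Lc Lc sp] .
  \<comment> \<open>The scalar matrix det W has bracket det W (L - T), whose coordinates are det W
    times \<open>d\<close>. As \<open>e\<close> is the Cramer solution of W e = det W d, subtracting
    the combination of \<open>y\<close> with weights \<open>e\<close> cancels it. Scaling by det W
    instead of dividing by it keeps \<open>x\<close> polynomial in T.\<close>
  define W where "W T = gram m y L (proj_u T)" for T
  define d where "d T q = (L - proj_u T) $$ (xs ! q)" for T q
  define e where "e T p = (\<Sum>q<m. adj_mat (W T) $$ (p, q) * d T q)" for T p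
  define x where "x T v = det (W T) * 1\<^sub>m n $$ v - (\<Sum>p<m. y p v * e T p)" for T v
  have fam: "polynomial_family n (UU D) (\<lambda>_. L)" "polynomial_family n (UU D) (proj_u :: 'k mat \<Rightarrow> 'k mat)"
    using polynomial_family_const[OF Lc] polynomial_family_proj by auto
  have W: "(\<lambda>T. W T $$ (r, s)) \<in> poly_funs (UU D)" if "r < m" "s < m" for r s
    using poly_funs_gram[OF m fam that] by (simp add: W_def)
  have d: "(\<lambda>T. d T q) \<in> poly_funs (UU D)" if "q < m" for q
  proof -
    have q: "q < length xs" using that m by simp
    obtain i j where ij: "xs ! q = (i, j)" "i < n" "j < n" using xs_bound[OF q] by auto
    have "d T q = L $$ (i, j) - proj_u T $$ (i, j)" for T
      using diff_index[OF Lc unit_comb_carrier q] ij by (simp add: d_def)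
    moreover have "(\<lambda>T :: 'k mat. proj_u T $$ (i, j)) \<in> poly_funs (UU D)"
      using fam(2) ij by (simp add: polynomial_family_def)
    ultimately show ?thesis using poly_funs_diff[OF poly_funs.const] by simp
  qed
  have "(\<lambda>T. x T v) \<in> poly_funs (UU D)" for v
    unfolding x_def e_def
    using W d
    by (intro poly_funs_diff poly_funs.mult poly_funs.const poly_funs_sum
        poly_funs_det[where m = m] poly_funs_adj_mat[where m = m])
      (auto simp: W_def)
  then have f: "(\<lambda>T. \<Prod>k<n. x T (k, k)) \<in> poly_funs (UU D)" by (intro poly_funs_prod)
  \<comment> \<open>At T = L the defect \<open>d\<close> vanishes and W is the identity, so
    \<open>x L\<close> gives the entries of the identity matrix.\<close>
  have "d L q = 0" if "q < m" for q
    using diff_index[OF Lc Lc, of q] that m proj_u_id[OF L] by (simp add: d_def)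
  then have "e L p = 0" for p by (simp add: e_def)
  then have "x L v = 1\<^sub>m n $$ v" for v
    using y proj_u_id[OF L] by (simp add: x_def W_def)
  then have fL: "(\<Prod>k<n. x L (k, k)) \<noteq> 0" by simp
  have "\<exists>g\<in>alg_g D. \<exists>h\<in>alg_g D. g * h = 1\<^sub>m n \<and> h * g = 1\<^sub>m n \<and> agree m (g * L) (T * g)"
    if T: "T \<in> ideal_u D" and nz: "(\<Prod>k<n. x T (k, k)) \<noteq> 0" for T
  proof -
    have Tc: "T \<in> carrier_mat n n" and pT: "proj_u T = T" using T ideal_u_carrier proj_u_id by auto
    define g where "g = unit_comb n (VV D) (x T)"
    have g: "g \<in> alg_g D" by (simp add: g_def alg_g_def unit_span_def)
    have gc: "g \<in> carrier_mat n n" by (simp add: g_def)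
    have "g $$ (k, k) \<noteq> 0" if "k < n" for k
      using nz that by (auto simp: g_def unit_comb_index VV_def weak_le_refl)
    then obtain h where h: "h \<in> alg_g D" "g * h = 1\<^sub>m n" "h * g = 1\<^sub>m n"
      using alg_g_inverse[OF g] by blast
    have "(g * L - T * g) $$ (xs ! r) = 0" if r: "r < m" for r
    proof -
      have r': "r < length xs" using r m by simp
      let ?b = "bracket_coef n L T (xs ! r)"
      have one: "unit_comb n (VV D) (\<lambda>v. 1\<^sub>m n $$ v) = 1\<^sub>m n"
        using unit_comb_self one_in_alg_g unfolding alg_g_def by blast
      have "(\<Sum>v\<in>VV D. ?b v * 1\<^sub>m n $$ v) = (1\<^sub>m n * L - T * 1\<^sub>m n) $$ (xs ! r)"
        using bracket_unit_comb[OF Lc Tc VV_bound xs_bound[OF r'], of "\<lambda>v. 1\<^sub>m n $$ v"] unfolding one by simp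
      also have "\<dots> = d T r" using Lc Tc pT by (simp add: d_def)
      finally have b1: "(\<Sum>v\<in>VV D. ?b v * 1\<^sub>m n $$ v) = d T r" .
      have "(\<Sum>p<m. W T $$ (r, p) * e T p) = (\<Sum>q<m. (\<Sum>p<m. W T $$ (r, p) * adj_mat (W T) $$ (p, q)) * d T q)"
        unfolding e_def sum_distrib_left sum_distrib_right by (subst sum.swap) (simp add: mult.assoc)
      also have "\<dots> = (\<Sum>q<m. if r = q then det (W T) * d T q else 0)"
        unfolding W_def by (intro sum.cong) (auto simp: gram_adj_mat[OF r])
      also have "\<dots> = det (W T) * d T r" using r by simp
      finally have We: "(\<Sum>p<m. W T $$ (r, p) * e T p) = det (W T) * d T r" .
      have "(g * L - T * g) $$ (xs ! r) = (\<Sum>v\<in>VV D. ?b v * x T v)"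
        unfolding g_def by (rule bracket_unit_comb[OF Lc Tc VV_bound xs_bound[OF r']])
      also have "\<dots> = det (W T) * (\<Sum>v\<in>VV D. ?b v * 1\<^sub>m n $$ v) - (\<Sum>v\<in>VV D. ?b v * (\<Sum>p<m. y p v * e T p))"
        unfolding x_def sum_distrib_left[of "det (W T)"]
        by (simp only: right_diff_distrib sum_subtractf mult.left_commute)
      also have "\<dots> = 0"
        unfolding gram_combination[OF r] b1 using We by (simp add: W_def pT)
      finally show ?thesis .
    qed
    then have "agree m (g * L) (T * g)"
      using diff_index[of "g * L" "T * g"] gc Lc Tc m by (auto simp: agree_def)
    then show ?thesis using g h by blast
  qed
  then show ?thesis using f fL by (intro bexI[of _ "\<lambda>T. \<Prod>k<n. x T (k, k)"]) auto
qed

end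

section \<open>The greedy procedure\<close>

lemma Lmat_update_index:
  assumes "(a, b) \<in> UU D" "lam (a, b) = 0" "i < num_ones D" "j < num_ones D"
  shows "Lmat D (lam((a, b) := t)) $$ (i, j) = Lmat D lam $$ (i, j) + (if i = a \<and> j = b then t else 0)"
  using assms by (auto simp: Lmat_def unit_comb_index)

text \<open>The coefficient at (a, b) enters the entry (a, b) only through X_aa on one side and X_bb
  on the other. Equal values s = t give the contribution t (X_aa - X_bb) of an edge; different
  values give s - t at X = 1, which separates the points of a line.\<close>

lemma bracket_update:
  assumes X: "X \<in> carrier_mat (num_ones D) (num_ones D)" and x: "(a, b) \<in> UU D" "lam (a, b) = (0 :: 'k::field)"
  shows "(X * Lmat D (lam((a, b) := s)) - Lmat D (lam((a, b) := t)) * X) $$ (a, b) =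
    (X * Lmat D lam - Lmat D lam * X) $$ (a, b) + s * X $$ (a, a) - t * X $$ (b, b)"
proof -
  let ?n = "num_ones D"
  have ab: "a < ?n" "b < ?n" using x UU_bound by auto
  have L: "Lmat D l \<in> carrier_mat ?n ?n" for l :: "nat \<times> nat \<Rightarrow> 'k"
    by (simp add: Lmat_def)
  have "(X * Lmat D (lam((a, b) := s))) $$ (a, b) =
      (\<Sum>k<?n. X $$ (a, k) * Lmat D lam $$ (k, b) + (if k = a then X $$ (a, a) * s else 0))"
    unfolding mult_mat_index[OF X L ab]
    using ab by (intro sum.cong) (auto simp: Lmat_update_index[where lam = lam, OF x] algebra_simps)
  also have "\<dots> = (X * Lmat D lam) $$ (a, b) + s * X $$ (a, a)"
    unfolding mult_mat_index[OF X L ab] using ab by (simp add: sum.distrib)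
  finally have 1: "(X * Lmat D (lam((a, b) := s))) $$ (a, b) = (X * Lmat D lam) $$ (a, b) + s * X $$ (a, a)" .
  have "(Lmat D (lam((a, b) := t)) * X) $$ (a, b) =
      (\<Sum>k<?n. Lmat D lam $$ (a, k) * X $$ (k, b) + (if k = b then t * X $$ (b, b) else 0))"
    unfolding mult_mat_index[OF L X ab]
    using ab by (intro sum.cong) (auto simp: Lmat_update_index[where lam = lam, OF x] algebra_simps)
  also have "\<dots> = (Lmat D lam * X) $$ (a, b) + t * X $$ (b, b)"
    unfolding mult_mat_index[OF L X ab] using ab by (simp add: sum.distrib)
  finally have 2: "(Lmat D (lam((a, b) := t)) * X) $$ (a, b) = (Lmat D lam * X) $$ (a, b) + t * X $$ (b, b)" .
  have "(M - M') $$ (a, b) = M $$ (a, b) - M' $$ (a, b)" if "M' \<in> carrier_mat ?n ?n" for M M' :: "'k mat"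
    using ab that by auto
  moreover have "Lmat D l * X \<in> carrier_mat ?n ?n" for l :: "nat \<times> nat \<Rightarrow> 'k"
    using L X by (rule mult_carrier_mat)
  ultimately have 3: "(X * Lmat D l - Lmat D l' * X) $$ (a, b) = (X * Lmat D l) $$ (a, b) - (Lmat D l' * X) $$ (a, b)"
    for l l' by blast
  show ?thesis unfolding 3 1 2 by (simp only: algebra_simps)
qed

lemma diagonal_mult_index:
  assumes "L \<in> carrier_mat n n" "i < n" "j < n"
  shows "(mat n n (\<lambda>(i, j). if i = j then t i else 0) * L) $$ (i, j) = t i * (L $$ (i, j) :: 'k::field)"
    and "(L * mat n n (\<lambda>(i, j). if i = j then t i else 0)) $$ (i, j) = L $$ (i, j) * t j"
proof -
  let ?T = "mat n n (\<lambda>(i, j). if i = j then t i else 0)"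
  have T: "?T \<in> carrier_mat n n" by simp
  have "(?T * L) $$ (i, j) = (\<Sum>k<n. if k = i then t i * L $$ (i, j) else 0)"
    unfolding mult_mat_index[OF T assms] using assms by (intro sum.cong) auto
  then show "(?T * L) $$ (i, j) = t i * L $$ (i, j)" using assms by simp
  have "(L * ?T) $$ (i, j) = (\<Sum>k<n. if k = j then L $$ (i, j) * t j else 0)"
    unfolding mult_mat_index[OF assms(1) T assms(2,3)] using assms by (intro sum.cong) auto
  then show "(L * ?T) $$ (i, j) = L $$ (i, j) * t j" using assms by simp
qed

lemma diagonal_in_alg_g: "mat (num_ones D) (num_ones D) (\<lambda>(i, j). if i = j then t i else 0) \<in> alg_g D"
  by (auto simp: alg_g_def unit_span_iff VV_def weak_le_refl)

lemma not_has_cycle_empty: "\<not> has_cycle {}"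
  by (auto simp: has_cycle_def intro!: exI[of _ 0])

lemma finite_supp: "finite (supp D lam)"
  using finite_UU by (simp add: supp_def)

lemma supp_indicator: "P \<subseteq> UU D \<Longrightarrow> supp D (\<lambda>x. if x \<in> P then 1 else 0 :: 'k::field) = P"
  by (auto simp: supp_def)

context adapted_order begin

text \<open>On a forest the torus acts transitively on the vectors with that support.\<close>

lemma spans_same_supp:
  fixes lam lam' :: "nat \<times> nat \<Rightarrow> 'k::field"
  assumes m: "m \<le> length xs" and "\<not> has_cycle (supp D lam)" "supp D lam' = supp D lam"
    and sp: "spans m (Lmat D lam) (Lmat D lam)"
  shows "spans m (Lmat D lam') (Lmat D lam')"
proof -
  have "supp D lam \<subseteq> {(i, j). i < j}" using UU_less by (auto simp: supp_def)
  moreover have "\<And>e. e \<in> supp D lam \<Longrightarrow> lam' e / lam e \<noteq> 0"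
    using assms(3) by (auto simp: supp_def)
  ultimately obtain t where t: "\<And>a. t a \<noteq> 0" "\<And>a b. (a, b) \<in> supp D lam \<Longrightarrow> t a = lam' (a, b) / lam (a, b) * t b"
    using forest_potential[OF finite_supp assms(2), of "\<lambda>e. lam' e / lam e"] by blast
  define g where "g = mat n n (\<lambda>(i, j). if i = j then t i else 0)"
  define h where "h = mat n n (\<lambda>(i, j). if i = j then 1 / t i else 0)"
  have gh: "g \<in> alg_g D" "h \<in> alg_g D" unfolding g_def h_def by (rule diagonal_in_alg_g)+
  have c: "g \<in> carrier_mat n n" "h \<in> carrier_mat n n" "Lmat D lam \<in> carrier_mat n n"
    using gh alg_g_carrier Lmat_in_ideal_u ideal_u_carrier by blast+
  have "(g * h) $$ (i, j) = (if i = j then 1 else 0)" "(h * g) $$ (i, j) = (if i = j then 1 else 0)"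
    if "i < n" "j < n" for i j
    unfolding g_def diagonal_mult_index[OF c(2) that]
    using that t(1) by (auto simp: h_def)
  then have inv: "g * h = 1\<^sub>m n" "h * g = 1\<^sub>m n"
    using c by (auto simp del: index_mult_mat(1) intro!: eq_matI)
  have "g * Lmat D lam * h = Lmat D lam'"
  proof (rule eq_matI)
    fix i j assume "i < dim_row (Lmat D lam')" "j < dim_col (Lmat D lam')"
    then have ij: "i < n" "j < n" by (auto simp: Lmat_def unit_comb_def)
    have gL: "g * Lmat D lam \<in> carrier_mat n n" using c by simp
    have "(g * Lmat D lam * h) $$ (i, j) = t i * Lmat D lam $$ (i, j) / t j"
      unfolding h_def diagonal_mult_index(2)[OF gL ij] unfolding g_def diagonal_mult_index(1)[OF c(3) ij] by simp
    also have "\<dots> = Lmat D lam' $$ (i, j)"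
    proof (cases "(i, j) \<in> supp D lam")
      case True
      then have "(i, j) \<in> UU D" "lam (i, j) \<noteq> 0" by (auto simp: supp_def)
      then show ?thesis using t(1)[of j] t(2)[OF True] by (simp add: Lmat_index)
    next
      case False
      moreover have "(i, j) \<notin> supp D lam'" using False assms(3) by simp
      ultimately show ?thesis
        using ij by (auto simp: Lmat_def unit_comb_index supp_def)
    qed
    finally show "(g * Lmat D lam * h) $$ (i, j) = Lmat D lam' $$ (i, j)" .
  qed (use c in \<open>auto simp: Lmat_def unit_comb_def\<close>)
  then show ?thesis
    using spans_conj[OF m Lmat_in_ideal_u Lmat_in_ideal_u gh inv gh inv sp] by simp
qed

lemma agree_Lmat_update: "m < length xs \<Longrightarrow> agree m (Lmat D (lam(xs ! m := t))) (Lmat D lam)"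
  using xs_UU xs_eq_iff by (auto simp: agree_def Lmat_index)

lemma spans_Lmat_update:
  assumes "m < length xs" "spans m (Lmat D lam) (Lmat D lam)"
  shows "spans m (Lmat D (lam(xs ! m := s))) (Lmat D (lam(xs ! m := t)))"
  using assms agree_Lmat_update[THEN agree_sym]
  by (intro spans_agree[OF _ Lmat_in_ideal_u Lmat_in_ideal_u Lmat_in_ideal_u Lmat_in_ideal_u _ _ assms(2)]) auto

text \<open>Quantifying over all \<open>lam\<close> with support P allows coefficients to be changed
  freely during a step. The inclusion in the first \<open>m\<close> elements ensures that
  \<open>xs ! m\<close> is new, and the type argument only names the field.\<close>

definition stage :: "'k::field itself \<Rightarrow> nat \<Rightarrow> (nat \<times> nat) set \<Rightarrow> bool" where
  "stage _ m P \<longleftrightarrow> P \<subseteq> set (take m xs) \<and> \<not> has_cycle P \<and>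
     (\<forall>lam :: nat \<times> nat \<Rightarrow> 'k. supp D lam = P \<longrightarrow> spans m (Lmat D lam) (Lmat D lam) \<and>
       (\<forall>X\<in>alg_g D. agree m (X * Lmat D lam) (Lmat D lam * X) \<longrightarrow> (\<forall>(a, b)\<in>P. X $$ (a, a) = X $$ (b, b))))"

lemma stage_0: "stage T 0 {}"
  using one_in_alg_g not_has_cycle_empty by (auto simp: stage_def spans_def agree_def supp_def)

lemma stage_UU: "stage T m P \<Longrightarrow> P \<subseteq> UU D"
  using set_xs set_take_subset by (fastforce simp: stage_def)

lemma stage_supp_exists:
  assumes "stage TYPE('k::field) m P"
  obtains lam :: "nat \<times> nat \<Rightarrow> 'k::field" where "supp D lam = P" "\<And>x. x \<notin> P \<Longrightarrow> lam x = 0"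
  by (rule that[OF supp_indicator[OF stage_UU[OF assms]]]) simp

lemma stage_new:
  assumes "stage T m P" "m < length xs"
  shows "xs ! m \<notin> P"
proof
  assume "xs ! m \<in> P"
  then have "xs ! m \<in> set (take m xs)" using assms by (auto simp: stage_def)
  then obtain r where "r < m" "xs ! m = xs ! r" by (auto simp: in_set_conv_nth)
  then show False using xs_eq_iff[of m r] assms(2) by simp
qed

text \<open>A stage has acyclic support, so diagonal matrices conjugate all vectors supported
  exactly on P into one another; testing one of them is testing all.\<close>

lemma stage_test:
  fixes lam lam' :: "nat \<times> nat \<Rightarrow> 'k::field"
  assumes "stage TYPE('k) m P" "m < length xs" "supp D lam = P" "supp D lam' = P"
    "spans (Suc m) (Lmat D lam) (Lmat D lam)"
  shows "spans (Suc m) (Lmat D lam') (Lmat D lam')"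
  using assms spans_same_supp[of "Suc m" lam lam'] by (auto simp: stage_def)

text \<open>Commuting modulo one more coordinate is a stronger condition on X, so the statement
  about diagonal entries is inherited.\<close>

lemma stage_independent:
  fixes lam :: "nat \<times> nat \<Rightarrow> 'k::field"
  assumes st: "stage TYPE('k) m P" and m: "m < length xs"
    and "supp D lam = P" "spans (Suc m) (Lmat D lam) (Lmat D lam)"
  shows "stage TYPE('k) (Suc m) P"
proof -
  have "set (take m xs) \<subseteq> set (take (Suc m) xs)" by (rule set_take_subset_set_take) simp
  moreover have "spans (Suc m) (Lmat D lam') (Lmat D lam')" if "supp D lam' = P" for lam' :: "nat \<times> nat \<Rightarrow> 'k"
    using stage_test[OF st m assms(3) that assms(4)] .
  ultimately show ?thesis using st unfolding stage_def agree_Suc by blast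
qed

lemma stabilizer_coordinate:
  fixes lam :: "nat \<times> nat \<Rightarrow> 'k::field"
  assumes m: "m < length xs" and "spans m (Lmat D lam) (Lmat D lam)" "\<not> spans (Suc m) (Lmat D lam) (Lmat D lam)"
    and "X \<in> alg_g D" "agree m (X * Lmat D lam) (Lmat D lam * X)"
  shows "(X * Lmat D lam - Lmat D lam * X) $$ (xs ! m) = 0"
  using spans_SucI[OF m Lmat_in_ideal_u Lmat_in_ideal_u] assms by blast

lemma agree_bracket_update:
  fixes lam :: "nat \<times> nat \<Rightarrow> 'k::field"
  assumes m: "m < length xs" and X: "X \<in> alg_g D"
  shows "agree m (X * Lmat D (lam(xs ! m := s))) (Lmat D (lam(xs ! m := t)) * X) \<longleftrightarrow>
    agree m (X * Lmat D lam) (Lmat D lam * X)"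
proof -
  have m': "m \<le> length xs" using m by simp
  have "agree m (X * Lmat D (lam(xs ! m := s))) (X * Lmat D lam)"
    by (rule agree_mult_left[OF m' X Lmat_in_ideal_u Lmat_in_ideal_u agree_Lmat_update[OF m]])
  moreover have "agree m (Lmat D (lam(xs ! m := t)) * X) (Lmat D lam * X)"
    by (rule agree_mult_right[OF m' X Lmat_in_ideal_u Lmat_in_ideal_u agree_Lmat_update[OF m]])
  ultimately show ?thesis using agree_trans agree_sym by metis
qed

lemma stage_insert:
  fixes lam :: "nat \<times> nat \<Rightarrow> 'k::field"
  assumes st: "stage TYPE('k) m P" and m: "m < length xs"
    and dep: "supp D lam = P" "\<not> spans (Suc m) (Lmat D lam) (Lmat D lam)"
    and acyclic: "\<not> has_cycle (insert (xs ! m) P)"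
  shows "stage TYPE('k) (Suc m) (insert (xs ! m) P)"
proof -
  obtain a b where ab: "xs ! m = (a, b)" by fastforce
  have xU: "(a, b) \<in> UU D" using xs_UU[OF m] ab by simp
  have xP: "(a, b) \<notin> P" using stage_new[OF st m] ab by simp
  have "a < b" using xU UU_less by auto
  moreover have "(b, a) \<notin> P" using stage_UU[OF st] UU_less \<open>a < b\<close> by (metis (mono_tags, lifting) case_prodD in_mono less_asym mem_Collect_eq)
  ultimately have nc: "(a, b) \<notin> connected_in P"
    using has_cycle_insert_if_connected[of a b P] acyclic ab xP by auto
  have "spans (Suc m) (Lmat D lam') (Lmat D lam') \<and>
      (\<forall>X\<in>alg_g D. agree (Suc m) (X * Lmat D lam') (Lmat D lam' * X) \<longrightarrow>
        (\<forall>(c, d)\<in>insert (xs ! m) P. X $$ (c, c) = X $$ (d, d)))"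
    if supp': "supp D lam' = insert (xs ! m) P" for lam' :: "nat \<times> nat \<Rightarrow> 'k"
  proof -
    \<comment> \<open>The new coefficient is split off: \<open>mu\<close> has support P, so the
      invariant of the old stage applies to it, and the first \<open>m\<close> coordinates do not
      see its difference from \<open>lam'\<close>.\<close>
    define mu where "mu = lam'((a, b) := 0)"
    have mu: "supp D mu = P" "mu (a, b) = 0"
      using supp' ab xP by (auto simp: mu_def supp_def)
    define t where "t = lam' (a, b)"
    have t: "t \<noteq> 0" using supp' ab by (auto simp: t_def supp_def)
    have lam': "lam' = mu(xs ! m := t)" using ab by (auto simp: mu_def t_def)
    have sp: "spans m (Lmat D mu) (Lmat D mu)" using st mu by (simp add: stage_def)
    have nsp: "\<not> spans (Suc m) (Lmat D mu) (Lmat D mu)"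
      using stage_test[OF st m mu(1) dep(1)] dep(2) by blast
    \<comment> \<open>The indicator of the component of \<open>a\<close>, which does not contain
      \<open>b\<close>. Edges of P stay inside components, so X commutes with L(mu), and only the
      new edge contributes, with value \<open>t\<close>.\<close>
    define X where "X = mat n n (\<lambda>(i, j). if i = j then (if (a, i) \<in> connected_in P then 1 else 0 :: 'k) else 0)"
    have X: "X \<in> alg_g D" unfolding X_def by (rule diagonal_in_alg_g)
    have Lc: "Lmat D mu \<in> carrier_mat n n" using Lmat_in_ideal_u ideal_u_carrier by blast
    have "X * Lmat D mu = Lmat D mu * X"
    proof (rule eq_matI)
      fix i j assume "i < dim_row (Lmat D mu * X)" "j < dim_col (Lmat D mu * X)"
      then have ij: "i < n" "j < n" using Lc by (auto simp: X_def)
      have "(a, i) \<in> connected_in P \<longleftrightarrow> (a, j) \<in> connected_in P" if "Lmat D mu $$ (i, j) \<noteq> 0"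
      proof -
        have "(i, j) \<in> P" using that ij mu by (auto simp: Lmat_def unit_comb_index supp_def split: if_splits)
        then show ?thesis by (meson UnCI converseI rtrancl.rtrancl_into_rtrancl)
      qed
      then show "(X * Lmat D mu) $$ (i, j) = (Lmat D mu * X) $$ (i, j)"
        unfolding X_def diagonal_mult_index[OF Lc ij] by auto
    qed (use Lc in \<open>auto simp: X_def\<close>)
    then have "agree m (X * Lmat D lam') (Lmat D lam' * X)"
      unfolding lam' agree_bracket_update[OF m X] by (simp add: agree_refl)
    moreover have "(X * Lmat D lam' - Lmat D lam' * X) $$ (xs ! m) = t"
    proof -
      have ab': "a < n" "b < n" using xU UU_bound by auto
      have "(X * Lmat D mu - Lmat D mu * X) $$ (a, b) = 0"
        using \<open>X * Lmat D mu = Lmat D mu * X\<close> ab' Lc by (simp add: X_def)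
      then show ?thesis
        unfolding lam' ab bracket_update[where lam = mu, OF alg_g_carrier[OF X] xU mu(2)]
        using ab' nc by (simp add: X_def)
    qed
    moreover have "spans m (Lmat D lam') (Lmat D lam')"
      unfolding lam' by (rule spans_Lmat_update[OF m sp])
    ultimately have "spans (Suc m) (Lmat D lam') (Lmat D lam')"
      using spans_SucI[OF m Lmat_in_ideal_u Lmat_in_ideal_u _ X] t by simp
    moreover have "\<forall>(c, d)\<in>insert (xs ! m) P. Y $$ (c, c) = Y $$ (d, d)"
      if Y: "Y \<in> alg_g D" "agree (Suc m) (Y * Lmat D lam') (Lmat D lam' * Y)" for Y
    proof -
      have ag: "agree m (Y * Lmat D mu) (Lmat D mu * Y)"
        using Y(2) agree_bracket_update[OF m Y(1), of mu t t] unfolding lam' agree_Suc by simp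
      have c: "Y * Lmat D lam' \<in> carrier_mat n n" "Lmat D lam' * Y \<in> carrier_mat n n"
        using Y(1) alg_g_carrier Lmat_in_ideal_u ideal_u_carrier by (metis mult_carrier_mat)+
      have "(Y * Lmat D lam' - Lmat D lam' * Y) $$ (xs ! m) = 0"
        unfolding diff_index[OF c m] using Y(2) by (simp add: agree_Suc)
      \<comment> \<open>The part of this coordinate that comes from \<open>mu\<close> vanishes by
        the dependence found in the test, which leaves the contribution of the new edge
        alone.\<close>
      then have "t * (Y $$ (a, a) - Y $$ (b, b)) = 0"
        using bracket_update[where lam = mu and s = t and t = t, OF alg_g_carrier[OF Y(1)] xU mu(2)]
          stabilizer_coordinate[OF m sp nsp Y(1) ag]
        unfolding lam' ab by (simp add: algebra_simps)
      then have "Y $$ (a, a) = Y $$ (b, b)" using t by simp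
      moreover have "\<forall>(c, d)\<in>P. Y $$ (c, c) = Y $$ (d, d)"
        using st mu(1) Y(1) ag unfolding stage_def by blast
      ultimately show ?thesis using ab by simp
    qed
    ultimately show ?thesis by blast
  qed
  moreover have "insert (xs ! m) P \<subseteq> set (take (Suc m) xs)"
    using st m by (auto simp: stage_def take_Suc_conv_app_nth)
  ultimately show ?thesis using acyclic unfolding stage_def by blast
qed

end

section \<open>Conjugation orbits and density\<close>

lemma conj_orbitE:
  assumes "T \<in> conj_orbit D Y"
  obtains g h where "g \<in> alg_g D" "h \<in> alg_g D" "g * h = 1\<^sub>m (num_ones D)" "h * g = 1\<^sub>m (num_ones D)"
    "T = g * Y * h"
  using assms unfolding conj_orbit_def by blast

lemma conj_orbitI:
  assumes "g \<in> alg_g D" "h \<in> alg_g D" "g * h = 1\<^sub>m (num_ones D)" "h * g = 1\<^sub>m (num_ones D)"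
  shows "g * Y * h \<in> conj_orbit D Y"
  using assms unfolding conj_orbit_def by blast

lemma conj_orbit_refl:
  assumes "Y \<in> ideal_u D"
  shows "Y \<in> conj_orbit D Y"
  using conj_orbitI[OF one_in_alg_g one_in_alg_g, of D Y] ideal_u_carrier[OF assms] by simp

lemma conj_orbit_subset: "Y \<in> ideal_u D \<Longrightarrow> conj_orbit D Y \<subseteq> ideal_u D"
  by (auto elim!: conj_orbitE intro: alg_g_mult_ideal_u ideal_u_mult_alg_g)

lemma conj_orbit_sym:
  assumes "T \<in> conj_orbit D Y" "Y \<in> ideal_u D"
  shows "Y \<in> conj_orbit D T"
proof -
  obtain g h where gh: "g \<in> alg_g D" "h \<in> alg_g D" "g * h = 1\<^sub>m (num_ones D)" "h * g = 1\<^sub>m (num_ones D)"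
    "T = g * Y * h" using assms(1) by (rule conj_orbitE)
  note c = alg_g_carrier[OF gh(1)] alg_g_carrier[OF gh(2)] ideal_u_carrier[OF assms(2)]
  have "h * T * g = (h * g) * Y * (h * g)"
    unfolding gh(5) using c by (simp add: assoc_mult_mat[of _ "num_ones D" "num_ones D" _ "num_ones D" _ "num_ones D"])
  also have "\<dots> = Y" using c gh by simp
  finally show ?thesis using conj_orbitI[OF gh(2,1,4,3), of T] by simp
qed

lemma conj_orbit_trans:
  assumes "S \<in> conj_orbit D T" "T \<in> conj_orbit D Y" "Y \<in> ideal_u D"
  shows "S \<in> conj_orbit D Y"
proof -
  let ?n = "num_ones D"
  obtain g h where gh: "g \<in> alg_g D" "h \<in> alg_g D" "g * h = 1\<^sub>m ?n" "h * g = 1\<^sub>m ?n" "T = g * Y * h"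
    using assms(2) by (rule conj_orbitE)
  obtain k l where kl: "k \<in> alg_g D" "l \<in> alg_g D" "k * l = 1\<^sub>m ?n" "l * k = 1\<^sub>m ?n" "S = k * T * l"
    using assms(1) by (rule conj_orbitE)
  note c = alg_g_carrier[OF gh(1)] alg_g_carrier[OF gh(2)] alg_g_carrier[OF kl(1)] alg_g_carrier[OF kl(2)]
    ideal_u_carrier[OF assms(3)]
  have inv: "A * B * (B' * A') = 1\<^sub>m ?n"
    if "A * A' = 1\<^sub>m ?n" "B * B' = 1\<^sub>m ?n" "A \<in> carrier_mat ?n ?n" "B \<in> carrier_mat ?n ?n"
      "A' \<in> carrier_mat ?n ?n" "B' \<in> carrier_mat ?n ?n" for A B A' B' :: "'a mat"
  proof -
    have "A * B * (B' * A') = A * (B * B') * A'"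
      using that(3-6) by (simp add: assoc_mult_mat[of _ ?n ?n _ ?n _ ?n])
    then show ?thesis using that by simp
  qed
  have "S = (k * g) * Y * (h * l)"
    unfolding kl(5) gh(5) using c by (simp add: assoc_mult_mat[of _ ?n ?n _ ?n _ ?n])
  moreover have "(k * g) * Y * (h * l) \<in> conj_orbit D Y"
    using gh(1-4) kl(1-4) c by (intro conj_orbitI alg_g_mult inv)
  ultimately show ?thesis by simp
qed

lemma zariski_denseI:
  assumes "Y \<subseteq> unit_span n S"
    and "\<And>f T. f \<in> poly_funs S \<Longrightarrow> T \<in> unit_span n S \<Longrightarrow> f T \<noteq> 0 \<Longrightarrow> \<exists>y\<in>Y. f y \<noteq> 0"
  shows "zariski_dense n S Y"
  unfolding zariski_dense_def
proof (intro conjI allI impI assms(1))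
  fix Z assume Z: "zariski_closed n S Z \<and> Y \<subseteq> Z"
  then obtain F where F: "F \<subseteq> poly_funs S" "Z = {X \<in> unit_span n S. \<forall>f\<in>F. f X = 0}"
    by (auto simp: zariski_closed_def)
  have "f T = 0" if "f \<in> F" "T \<in> unit_span n S" for f T
    using assms(2)[of f T] that F Z by blast
  then show "Z = unit_span n S" using F(2) by blast
qed

lemma connected_in_constant:
  assumes "(a, b) \<in> connected_in P" "\<forall>(c, d)\<in>P. f c = f d"
  shows "f a = f b"
  using assms(1)
proof (induction rule: rtrancl_induct)
  case (step c d)
  then show ?case using assms(2) by auto
qed simp

context adapted_order begin

text \<open>Each argument moves in its own orbit, so surjectivity is an invariant of pairs of
  orbits.\<close>

lemma spans_conj_orbit:
  assumes "m \<le> length xs" "Y \<in> ideal_u D" "Z \<in> ideal_u D" "spans m Y Z"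
    and "Y' \<in> conj_orbit D Y" "Z' \<in> conj_orbit D Z"
  shows "spans m Y' Z'"
proof -
  obtain g g' where g: "g \<in> alg_g D" "g' \<in> alg_g D" "g * g' = 1\<^sub>m n" "g' * g = 1\<^sub>m n" "Y' = g * Y * g'"
    using assms(5) by (rule conj_orbitE)
  obtain h h' where h: "h \<in> alg_g D" "h' \<in> alg_g D" "h * h' = 1\<^sub>m n" "h' * h = 1\<^sub>m n" "Z' = h * Z * h'"
    using assms(6) by (rule conj_orbitE)
  show ?thesis
    unfolding g(5) h(5) by (rule spans_conj[OF assms(1-3) g(1-4) h(1-4) assms(4)])
qed

text \<open>Multiplying the agreement of g L and T g by the inverse of g conjugates T into agreement
  with L in the first \<open>m\<close> coordinates; the other coordinates of the conjugate stay
  unconstrained.\<close>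

lemma conj_orbit_open:
  fixes L :: "'k::field mat"
  assumes m: "m \<le> length xs" and L: "L \<in> ideal_u D" and sp: "spans m L L"
  shows "\<exists>f\<in>poly_funs (UU D). f L \<noteq> 0 \<and>
    (\<forall>T\<in>ideal_u D. f T \<noteq> 0 \<longrightarrow> (\<exists>S\<in>conj_orbit D T. agree m S L))"
proof -
  obtain f where f: "f \<in> poly_funs (UU D)" "f L \<noteq> 0" "\<And>T. T \<in> ideal_u D \<Longrightarrow> f T \<noteq> 0 \<Longrightarrow>
      \<exists>g\<in>alg_g D. \<exists>h\<in>alg_g D. g * h = 1\<^sub>m n \<and> h * g = 1\<^sub>m n \<and> agree m (g * L) (T * g)"
    using spans_conj_open[OF assms] by blast
  have "\<exists>S\<in>conj_orbit D T. agree m S L" if T: "T \<in> ideal_u D" "f T \<noteq> 0" for T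
  proof -
    obtain g h where gh: "g \<in> alg_g D" "h \<in> alg_g D" "g * h = 1\<^sub>m n" "h * g = 1\<^sub>m n" "agree m (g * L) (T * g)"
      using f(3)[OF T] by blast
    note c = alg_g_carrier[OF gh(1)] alg_g_carrier[OF gh(2)] ideal_u_carrier[OF L] ideal_u_carrier[OF T(1)]
    have "agree m (h * (g * L)) (h * (T * g))"
      by (rule agree_mult_left[OF m gh(2) alg_g_mult_ideal_u[OF gh(1) L] ideal_u_mult_alg_g[OF T(1) gh(1)] gh(5)])
    moreover have "h * (g * L) = L"
      using c gh(4) by (simp add: assoc_mult_mat[of h n n g n L n, symmetric])
    moreover have "h * (T * g) = h * T * g"
      using c by (simp add: assoc_mult_mat[of h n n T n g n])
    ultimately have "agree m (h * T * g) L" by (simp add: agree_sym)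
    then show ?thesis using conj_orbitI[OF gh(2,1,4,3)] by blast
  qed
  then show ?thesis using f(1,2) by blast
qed

section \<open>The situation at an abort\<close>

context
  fixes m :: nat and P :: "(nat \<times> nat) set" and lam :: "nat \<times> nat \<Rightarrow> 'k::alg_closed_field"
  assumes st: "stage TYPE('k) m P" and m: "m < length xs"
    and supp: "supp D lam = P" and dep: "\<not> spans (Suc m) (Lmat D lam) (Lmat D lam)"
    and cyc: "has_cycle (insert (xs ! m) P)"
begin

abbreviation fiber :: "'k \<Rightarrow> 'k mat" where
  "fiber t \<equiv> Lmat D (lam(xs ! m := t))"

lemma abort_lam_0: "lam (xs ! m) = 0"
  using supp stage_new[OF st m] xs_UU[OF m] by (auto simp: supp_def)

lemma abort_spans: "spans m (Lmat D lam) (Lmat D lam)"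
  using st supp by (simp add: stage_def)

lemma abort_Suc: "Suc m \<le> length xs"
  using m by simp

lemma abort_bracket:
  assumes "X \<in> alg_g D" "xs ! m = (a, b)"
  shows "(X * fiber s - fiber t * X) $$ (xs ! m) =
    (X * Lmat D lam - Lmat D lam * X) $$ (xs ! m) + s * X $$ (a, a) - t * X $$ (b, b)"
  using bracket_update[where lam = lam, OF alg_g_carrier[OF assms(1)], of a b s t] xs_UU[OF m] abort_lam_0 assms(2)
  by simp

text \<open>A preimage X of the matrix unit at \<open>xs ! m\<close> would commute with L(lam)
  modulo the first \<open>m\<close> coordinates, so its diagonal would be constant on the components
  of P. The cycle puts both ends of the new edge into one component, which makes coordinate
  \<open>m\<close> of the bracket 0 instead of 1.\<close>

lemma abort_fiber: "\<not> spans (Suc m) (fiber t) (fiber t)"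
proof
  assume sp: "spans (Suc m) (fiber t) (fiber t)"
  obtain a b where ab: "xs ! m = (a, b)" by fastforce
  have "(matrix_unit n (xs ! m) :: 'k mat) \<in> ideal_u D" by (rule matrix_unit_in_ideal_u[OF xs_UU[OF m]])
  then obtain X where X: "X \<in> alg_g D" "agree (Suc m) (X * fiber t - fiber t * X) (matrix_unit n (xs ! m))"
    using sp by (auto simp: spans_def)
  have F: "fiber t \<in> carrier_mat n n" using Lmat_in_ideal_u ideal_u_carrier by blast
  have c: "X * fiber t \<in> carrier_mat n n" "fiber t * X \<in> carrier_mat n n"
    using alg_g_carrier[OF X(1)] F by auto
  have "agree m (X * fiber t) (fiber t * X)"
    unfolding agree_def
  proof (intro allI impI)
    fix r assume r: "r < m"
    then have r': "r < length xs" using m by simp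
    have "(X * fiber t - fiber t * X) $$ (xs ! r) = matrix_unit n (xs ! m) $$ (xs ! r)"
      using X(2) r by (simp add: agree_def)
    also have "\<dots> = 0"
      using xs_bound[OF r'] xs_eq_iff[OF r' m] r by (auto simp: matrix_unit_def)
    finally show "(X * fiber t) $$ (xs ! r) = (fiber t * X) $$ (xs ! r)"
      unfolding diff_index[OF c r'] by simp
  qed
  then have ag: "agree m (X * Lmat D lam) (Lmat D lam * X)"
    using agree_bracket_update[OF m X(1), of lam t t] by simp
  have "(a, b) \<in> connected_in P"
    using connected_if_has_cycle_insert[of a b P] cyc ab st by (simp add: stage_def)
  moreover have "\<forall>(c, d)\<in>P. X $$ (c, c) = X $$ (d, d)"
    using st supp X(1) ag unfolding stage_def by blast
  ultimately have "X $$ (a, a) = X $$ (b, b)"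
    by (rule connected_in_constant)
  then have "(X * fiber t - fiber t * X) $$ (xs ! m) = 0"
    unfolding abort_bracket[OF X(1) ab] stabilizer_coordinate[OF m abort_spans dep X(1) ag] by simp
  moreover have "(X * fiber t - fiber t * X) $$ (xs ! m) = matrix_unit n (xs ! m) $$ (xs ! m)"
    using X(2) by (simp add: agree_def)
  moreover have "matrix_unit n (xs ! m) $$ (xs ! m) = (1 :: 'k)"
    using xs_bound[OF m] by (auto simp: matrix_unit_def)
  ultimately show False by simp
qed

text \<open>A generic T can be conjugated into agreement with L(lam) in the first \<open>m\<close>
  coordinates; the parameter t is then just the next coordinate of the conjugate.\<close>

lemma abort_generic:
  "\<exists>f\<in>poly_funs (UU D). f (Lmat D lam) \<noteq> 0 \<and>
    (\<forall>T\<in>ideal_u D. f T \<noteq> 0 \<longrightarrow> (\<exists>S\<in>conj_orbit D T. \<exists>t. agree (Suc m) S (fiber t)))"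
proof -
  obtain f where f: "f \<in> poly_funs (UU D)" "f (Lmat D lam) \<noteq> 0"
    "\<And>T. T \<in> ideal_u D \<Longrightarrow> f T \<noteq> 0 \<Longrightarrow> \<exists>S\<in>conj_orbit D T. agree m S (Lmat D lam)"
    using conj_orbit_open[OF less_imp_le[OF m] Lmat_in_ideal_u abort_spans] by blast
  have "agree (Suc m) S (fiber (S $$ (xs ! m)))" if "agree m S (Lmat D lam)" for S
    using agree_trans[OF that agree_sym[OF agree_Lmat_update[OF m]]] xs_UU[OF m] by (simp add: agree_Suc Lmat_index)
  then show ?thesis using f by blast
qed

text \<open>Surjectivity at one Y would spread to a nonempty open set. This set meets the open set
  of points conjugate into the line, which would carry surjectivity to some
  \<open>fiber t\<close>.\<close>

lemma abort_dependent:
  assumes Y: "Y \<in> ideal_u D"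
  shows "\<not> spans (Suc m) Y (Y :: 'k mat)"
proof
  assume sp: "spans (Suc m) Y Y"
  obtain f where f: "f \<in> poly_funs (UU D)" "f (Lmat D lam) \<noteq> 0"
    "\<And>T. T \<in> ideal_u D \<Longrightarrow> f T \<noteq> 0 \<Longrightarrow> \<exists>S\<in>conj_orbit D T. \<exists>t. agree (Suc m) S (fiber t)"
    using abort_generic by blast
  have "spans (Suc m) (proj_u Y) (proj_u Y)" using sp proj_u_id[OF Y] by simp
  then obtain f' where f': "f' \<in> poly_funs (UU D)" "f' Y \<noteq> 0" "\<And>T. f' T \<noteq> 0 \<Longrightarrow> spans (Suc m) (proj_u T) (proj_u T)"
    using spans_open[OF abort_Suc polynomial_family_proj polynomial_family_proj, of Y] by blast
  obtain T where T: "T \<in> ideal_u D" "f T \<noteq> 0" "f' T \<noteq> 0"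
    using poly_funs_common_nonzero[OF f(1) f'(1) UU_bound] f(2) f'(2) Y Lmat_in_ideal_u unfolding ideal_u_def by blast
  obtain S t where S: "S \<in> conj_orbit D T" "agree (Suc m) S (fiber t)" using f(3) T by blast
  have "spans (Suc m) T T" using f'(3)[OF T(3)] proj_u_id[OF T(1)] by simp
  then have "spans (Suc m) S S" by (rule spans_conj_orbit[OF abort_Suc T(1) T(1) _ S(1) S(1)])
  moreover have "S \<in> ideal_u D" using S(1) conj_orbit_subset[OF T(1)] by blast
  ultimately have "spans (Suc m) (fiber t) (fiber t)"
    using spans_agree[OF abort_Suc _ Lmat_in_ideal_u _ Lmat_in_ideal_u S(2) S(2)] by blast
  then show False using abort_fiber by blast
qed

text \<open>
  A dense orbit would contain a point conjugate to \<open>fiber t\<close> in the first \<open>Suc m\<close> coordinates,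
  and also one conjugate to a point \<open>T\<close> for which $X \mapsto X \, \mathit{fiber}(t) - T X$ is
  surjective, as it is at $T = \mathit{fiber}(t + 1)$; conjugating, it would be so at $T = \mathit{fiber}(t)$.
\<close>

lemma abort_not_rigid: "\<not> rigid TYPE('k) D"
proof
  assume "rigid TYPE('k) D"
  then obtain Y :: "'k mat" where Y: "Y \<in> ideal_u D" and dense: "zariski_dense n (UU D) (conj_orbit D Y)"
    by (auto simp: rigid_def)
  obtain f where f: "f \<in> poly_funs (UU D)" "f (Lmat D lam) \<noteq> 0"
    "\<And>T. T \<in> ideal_u D \<Longrightarrow> f T \<noteq> 0 \<Longrightarrow> \<exists>S\<in>conj_orbit D T. \<exists>t. agree (Suc m) S (fiber t)"
    using abort_generic by blast
  obtain T where T: "T \<in> conj_orbit D Y" "f T \<noteq> 0"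
    using zariski_dense_nonzero[OF dense f(1) _ f(2)] Lmat_in_ideal_u unfolding ideal_u_def by blast
  have Tu: "T \<in> ideal_u D" using T(1) conj_orbit_subset[OF Y] by blast
  obtain S t where S: "S \<in> conj_orbit D T" "agree (Suc m) S (fiber t)" using f(3) T Tu by blast
  have Su: "S \<in> ideal_u D" using S(1) conj_orbit_subset[OF Tu] by blast
  have SY: "S \<in> conj_orbit D Y" using conj_orbit_trans[OF S(1) T(1) Y] .
  obtain a b where ab: "xs ! m = (a, b)" by fastforce
  have lt: "a < n" "b < n" using xs_bound[OF m] ab by auto
  have one: "(1\<^sub>m n :: 'k mat) \<in> alg_g D" by (rule one_in_alg_g)
  have Lc: "Lmat D lam \<in> carrier_mat n n" using Lmat_in_ideal_u ideal_u_carrier by blast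
  \<comment> \<open>X = 1 is the correcting element: the two fibers agree below \<open>m\<close>,
    and at \<open>m\<close> they differ by t - (t + 1), which is nonzero in every
    characteristic.\<close>
  have "spans (Suc m) (fiber t) (fiber (t + 1))"
  proof (rule spans_SucI[OF m Lmat_in_ideal_u Lmat_in_ideal_u spans_Lmat_update[OF m abort_spans] one])
    show "agree m (1\<^sub>m n * fiber t) (fiber (t + 1) * 1\<^sub>m n)"
      unfolding agree_bracket_update[OF m one] using Lc by (simp add: agree_refl)
    show "(1\<^sub>m n * fiber t - fiber (t + 1) * 1\<^sub>m n) $$ (xs ! m) \<noteq> 0"
      unfolding abort_bracket[OF one ab] using Lc lt ab by simp
  qed
  then have "spans (Suc m) (fiber t) (proj_u (fiber (t + 1)))"
    by (simp only: proj_u_id[OF Lmat_in_ideal_u])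
  then obtain f' where f': "f' \<in> poly_funs (UU D)" "f' (fiber (t + 1)) \<noteq> 0"
    "\<And>T. f' T \<noteq> 0 \<Longrightarrow> spans (Suc m) (fiber t) (proj_u T)"
    using spans_open[OF abort_Suc polynomial_family_const[OF ideal_u_carrier[OF Lmat_in_ideal_u]]
        polynomial_family_proj, of "lam(xs ! m := t)" "fiber (t + 1)"] by blast
  obtain T' where T': "T' \<in> conj_orbit D Y" "f' T' \<noteq> 0"
    using zariski_dense_nonzero[OF dense f'(1) _ f'(2)] Lmat_in_ideal_u unfolding ideal_u_def by blast
  have T'u: "T' \<in> ideal_u D" using T'(1) conj_orbit_subset[OF Y] by blast
  have "spans (Suc m) (fiber t) T'" using f'(3)[OF T'(2)] proj_u_id[OF T'u] by simp
  \<comment> \<open>S and T' both lie in the dense orbit, so the second argument can be moved from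
    T' to S, and S agrees with \<open>fiber t\<close> in all coordinates that matter.\<close>
  moreover have "S \<in> conj_orbit D T'"
    using conj_orbit_trans[OF SY conj_orbit_sym[OF T'(1) Y] T'u] .
  ultimately have "spans (Suc m) (fiber t) S"
    using spans_conj_orbit[OF abort_Suc Lmat_in_ideal_u T'u _ conj_orbit_refl[OF Lmat_in_ideal_u]] by blast
  then have "spans (Suc m) (fiber t) (fiber t)"
    by (rule spans_agree[OF abort_Suc Lmat_in_ideal_u Lmat_in_ideal_u Su Lmat_in_ideal_u agree_refl S(2)])
  then show False using abort_fiber by blast
qed

end

text \<open>For m = \<open>length xs\<close> agreement in the ideal is equality, so a nonempty open
  set lies in the orbit of L itself, and by irreducibility every nonempty principal open set meets
  it.\<close>

lemma rigid_if_spans: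
  fixes L :: "'k::alg_closed_field mat"
  assumes L: "L \<in> ideal_u D" and sp: "spans (length xs) L L"
  shows "rigid TYPE('k) D"
proof -
  obtain f where f: "f \<in> poly_funs (UU D)" "f L \<noteq> 0"
    "\<And>T. T \<in> ideal_u D \<Longrightarrow> f T \<noteq> 0 \<Longrightarrow> \<exists>S\<in>conj_orbit D T. agree (length xs) S L"
    using conj_orbit_open[OF _ L sp] by blast
  have "zariski_dense n (UU D) (conj_orbit D L)"
  proof (rule zariski_denseI)
    show "conj_orbit D L \<subseteq> unit_span n (UU D)" using conj_orbit_subset[OF L] by (simp add: ideal_u_def)
    fix h and T :: "'k mat" assume h: "h \<in> poly_funs (UU D)" "T \<in> unit_span n (UU D)" "h T \<noteq> 0"
    then obtain C where C: "C \<in> ideal_u D" "h C \<noteq> 0" "f C \<noteq> 0"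
      using poly_funs_common_nonzero[OF h(1) f(1) UU_bound] f(2) L unfolding ideal_u_def by blast
    obtain S where S: "S \<in> conj_orbit D C" "agree (length xs) S L" using f(3) C by blast
    then have "S = L" using agree_all conj_orbit_subset[OF C(1)] L by blast
    then show "\<exists>y\<in>conj_orbit D L. h y \<noteq> 0" using conj_orbit_sym S(1) C by blast
  qed
  then show ?thesis using L by (auto simp: rigid_def)
qed

section \<open>The invariant along a run of the procedure\<close>

lemma greedy_test:
  assumes "stage TYPE('k::field) i P" "i < length xs"
  shows "(\<exists>lam :: nat \<times> nat \<Rightarrow> 'k::field. supp D lam = P \<and> rows_dependent (Mmat D xs lam) (Suc i)) \<longleftrightarrow>
    (\<forall>lam :: nat \<times> nat \<Rightarrow> 'k. supp D lam = P \<longrightarrow> rows_dependent (Mmat D xs lam) (Suc i))"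
proof -
  obtain lam :: "nat \<times> nat \<Rightarrow> 'k" where "supp D lam = P" using stage_supp_exists[OF assms(1)] .
  moreover have "rows_dependent (Mmat D xs lam') (Suc i)"
    if "supp D mu = P" "rows_dependent (Mmat D xs mu) (Suc i)" "supp D lam' = P" for mu lam' :: "nat \<times> nat \<Rightarrow> 'k"
    using stage_test[OF assms that(3,1)] that(2) assms(2) by (auto simp: rows_dependent_iff Suc_le_eq)
  ultimately show ?thesis by blast
qed

lemma greedy_stage:
  assumes "greedy TYPE('k::field) D xs i = Some P" "i \<le> length xs"
  shows "stage TYPE('k) i P"
  using assms
proof (induction i arbitrary: P)
  case 0
  then show ?case by (simp add: stage_0)
next
  case (Suc i)
  then obtain Q where Q: "greedy TYPE('k) D xs i = Some Q" by (auto split: option.splits)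
  then have st: "stage TYPE('k) i Q" using Suc by simp
  have i: "i < length xs" using Suc.prems by simp
  show ?case
  proof (cases "\<exists>lam :: nat \<times> nat \<Rightarrow> 'k. supp D lam = Q \<and> rows_dependent (Mmat D xs lam) (Suc i)")
    case True
    then have "P = insert (xs ! i) Q" "\<not> has_cycle P"
      using Suc.prems(1) Q by (auto simp: Let_def split: if_splits)
    then show ?thesis
      using True stage_insert[OF st i] i by (auto simp: rows_dependent_iff Suc_le_eq)
  next
    case False
    then have "P = Q" using Suc.prems(1) Q by (auto simp: Let_def split: if_splits)
    moreover obtain lam :: "nat \<times> nat \<Rightarrow> 'k" where "supp D lam = Q" using stage_supp_exists[OF st] .
    ultimately show ?thesis
      using False stage_independent[OF st i] i by (auto simp: rows_dependent_iff Suc_le_eq)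
  qed
qed

text \<open>The state before the abort has no cycle, so the abort comes from an insertion, that is,
  from a dependent test.\<close>

lemma greedy_abort:
  assumes "greedy TYPE('k::field) D xs i = Some P" "greedy TYPE('k) D xs (Suc i) = None" "i < length xs"
  obtains lam :: "nat \<times> nat \<Rightarrow> 'k::field" where "stage TYPE('k) i P" "supp D lam = P"
    "\<not> spans (Suc i) (Lmat D lam) (Lmat D lam)" "has_cycle (insert (xs ! i) P)"
proof -
  have st: "stage TYPE('k) i P" using greedy_stage[OF assms(1)] assms(3) by simp
  then have "\<not> has_cycle P" by (simp add: stage_def)
  then have "\<exists>lam :: nat \<times> nat \<Rightarrow> 'k. supp D lam = P \<and> rows_dependent (Mmat D xs lam) (Suc i)"
    and "has_cycle (insert (xs ! i) P)"
    using assms(1,2) by (auto simp: Let_def split: if_splits)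
  then show ?thesis using that st assms(3) by (auto simp: rows_dependent_iff Suc_le_eq)
qed

lemma length_xs: "length xs = card (UU D)"
  using distinct_card[OF distinct_xs] set_xs by simp

lemma mat_rank_Mmat:
  "mat_rank (Mmat D xs lam) \<le> card (UU D)"
  "mat_rank (Mmat D xs lam) = card (UU D) \<longleftrightarrow> \<not> rows_dependent (Mmat D xs lam) (length xs)"
proof -
  have "dim_row (Mmat D xs lam) = length xs" by (simp add: Mmat_def)
  then show "mat_rank (Mmat D xs lam) \<le> card (UU D)"
    "mat_rank (Mmat D xs lam) = card (UU D) \<longleftrightarrow> \<not> rows_dependent (Mmat D xs lam) (length xs)"
    using mat_rank_le_dim_row[of "Mmat D xs lam"] mat_rank_eq_dim_row_iff[of "Mmat D xs lam"] length_xs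
    by simp_all
qed

lemma greedy_None:
  assumes "greedy T D xs k = None"
  shows "\<exists>i<k. greedy T D xs i \<noteq> None \<and> greedy T D xs (Suc i) = None"
  using assms
proof (induction k)
  case (Suc k)
  then show ?case by (cases "greedy T D xs k = None") (auto intro: less_SucI)
qed simp

end

theorem theorem4p4:
  fixes D :: "nat mat" and xs :: "(nat \<times> nat) list"
  assumes "incidence_matrix D"
    and "adapted_enumeration D xs"
  shows
    \<comment> \<open>the test performed at step \<open>Suc i\<close> does not depend on the chosen lambda\<close>
    "(\<forall>i<length xs. \<forall>P. greedy TYPE('k::alg_closed_field) D xs i = Some P \<longrightarrow>
       ((\<exists>lam :: nat \<times> nat \<Rightarrow> 'k. supp D lam = P \<and> rows_dependent (Mmat D xs lam) (Suc i)) \<longleftrightarrow>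
        (\<forall>lam :: nat \<times> nat \<Rightarrow> 'k. supp D lam = P \<longrightarrow> rows_dependent (Mmat D xs lam) (Suc i)))) \<and>
     (greedy TYPE('k) D xs (length xs) \<noteq> None \<longleftrightarrow> rigid TYPE('k) D) \<and>
     (\<forall>P. greedy TYPE('k) D xs (length xs) = Some P \<longrightarrow>
       forest_on {..<num_ones D} P \<and> card P \<le> num_ones D - 1 \<and>
       (\<forall>lam :: nat \<times> nat \<Rightarrow> 'k. supp D lam = P \<longrightarrow> mat_rank (Mmat D xs lam) = card (UU D)) \<and>
       mat_rank (Mmat D xs (\<lambda>x. if x \<in> P then 1 else 0 :: 'k)) = card (UU D)) \<and>
     (\<forall>i<length xs. greedy TYPE('k) D xs i \<noteq> None \<and> greedy TYPE('k) D xs (Suc i) = None \<longrightarrow>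
       (\<forall>lam :: nat \<times> nat \<Rightarrow> 'k. rows_dependent (Mmat D xs lam) (Suc i) \<and>
          mat_rank (Mmat D xs lam) < card (UU D)))"
proof -
  interpret adapted_order D xs using assms(2) by unfold_locales
  have success: "forest_on {..<n} P \<and> card P \<le> n - 1 \<and> P \<subseteq> UU D \<and>
      (\<forall>lam :: nat \<times> nat \<Rightarrow> 'k. supp D lam = P \<longrightarrow> spans (length xs) (Lmat D lam) (Lmat D lam))"
    if "greedy TYPE('k) D xs (length xs) = Some P" for P
  proof -
    have st: "stage TYPE('k) (length xs) P" using greedy_stage[OF that] by simp
    have P: "P \<subseteq> UU D" "\<not> has_cycle P" using stage_UU[OF st] st by (auto simp: stage_def)
    then have "P \<subseteq> {..<n} \<times> {..<n}" "P \<subseteq> {(i, j). i < j}" "finite P"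
      using UU_bound UU_less finite_UU finite_subset by blast+
    then show ?thesis
      using forest_card_less[of P "{..<n}"] P st by (auto simp: forest_on_def stage_def)
  qed
  have rank: "mat_rank (Mmat D xs lam) = card (UU D)" if "spans (length xs) (Lmat D lam) (Lmat D lam)" for lam :: "nat \<times> nat \<Rightarrow> 'k"
    using that by (simp add: mat_rank_Mmat(2) rows_dependent_iff)
  have abort: "\<not> rigid TYPE('k) D \<and> (\<forall>lam :: nat \<times> nat \<Rightarrow> 'k. rows_dependent (Mmat D xs lam) (Suc i))"
    if i: "i < length xs" and some: "greedy TYPE('k) D xs i \<noteq> None" and none: "greedy TYPE('k) D xs (Suc i) = None" for i
  proof -
    obtain P where P: "greedy TYPE('k) D xs i = Some P" using some by blast
    obtain lam :: "nat \<times> nat \<Rightarrow> 'k" where "stage TYPE('k) i P" "supp D lam = P"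
      "\<not> spans (Suc i) (Lmat D lam) (Lmat D lam)" "has_cycle (insert (xs ! i) P)"
      using greedy_abort[OF P none i] .
    \<comment> \<open>The facts are put into the order of the assumptions of the abort
      context.\<close>
    note ctx = this(1) i this(2-4)
    show ?thesis
      using abort_not_rigid[OF ctx] abort_dependent[OF ctx Lmat_in_ideal_u] i
      by (simp add: rows_dependent_iff Suc_le_eq)
  qed
  have rank_less: "mat_rank (Mmat D xs lam) < card (UU D)"
    if "i < length xs" "rows_dependent (Mmat D xs lam) (Suc i)" for i and lam :: "nat \<times> nat \<Rightarrow> 'k"
    using rows_dependent_mono[OF that(2), of "length xs"] that(1) mat_rank_Mmat[of lam] by linarith
  have rigid: "greedy TYPE('k) D xs (length xs) \<noteq> None \<longleftrightarrow> rigid TYPE('k) D"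
  proof
    assume "greedy TYPE('k) D xs (length xs) \<noteq> None"
    then obtain P where P: "greedy TYPE('k) D xs (length xs) = Some P" by blast
    have "stage TYPE('k) (length xs) P" using greedy_stage[OF P] by simp
    then obtain lam :: "nat \<times> nat \<Rightarrow> 'k" where "supp D lam = P" by (rule stage_supp_exists)
    then show "rigid TYPE('k) D" using success[OF P] rigid_if_spans[OF Lmat_in_ideal_u] by blast
  next
    assume "rigid TYPE('k) D"
    then show "greedy TYPE('k) D xs (length xs) \<noteq> None" using greedy_None abort by blast
  qed
  have test: "(\<exists>lam :: nat \<times> nat \<Rightarrow> 'k. supp D lam = P \<and> rows_dependent (Mmat D xs lam) (Suc i)) \<longleftrightarrow>
      (\<forall>lam :: nat \<times> nat \<Rightarrow> 'k. supp D lam = P \<longrightarrow> rows_dependent (Mmat D xs lam) (Suc i))"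
    if "i < length xs" "greedy TYPE('k) D xs i = Some P" for i P
    using greedy_test[OF greedy_stage[OF that(2)] that(1)] that(1) by simp
  have forest: "forest_on {..<n} P \<and> card P \<le> n - 1 \<and>
      (\<forall>lam :: nat \<times> nat \<Rightarrow> 'k. supp D lam = P \<longrightarrow> mat_rank (Mmat D xs lam) = card (UU D)) \<and>
      mat_rank (Mmat D xs (\<lambda>x. if x \<in> P then 1 else 0 :: 'k)) = card (UU D)"
    if "greedy TYPE('k) D xs (length xs) = Some P" for P
    using success[OF that] rank supp_indicator[where 'k = 'k, of P D] by simp
  show ?thesis
  proof (intro conjI allI impI)
    show "greedy TYPE('k) D xs (length xs) \<noteq> None \<longleftrightarrow> rigid TYPE('k) D" by (rule rigid)
  next
    fix i P assume "i < length xs" "greedy TYPE('k) D xs i = Some P"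
    then show "(\<exists>lam :: nat \<times> nat \<Rightarrow> 'k. supp D lam = P \<and> rows_dependent (Mmat D xs lam) (Suc i)) \<longleftrightarrow>
        (\<forall>lam :: nat \<times> nat \<Rightarrow> 'k. supp D lam = P \<longrightarrow> rows_dependent (Mmat D xs lam) (Suc i))"
      by (rule test)
  next
    fix P assume "greedy TYPE('k) D xs (length xs) = Some P"
    note F = forest[OF this]
    show "forest_on {..<n} P" "card P \<le> n - 1"
      "mat_rank (Mmat D xs (\<lambda>x. if x \<in> P then 1 else 0 :: 'k)) = card (UU D)"
      using F by blast+
    show "mat_rank (Mmat D xs lam) = card (UU D)" if "supp D lam = P" for lam :: "nat \<times> nat \<Rightarrow> 'k"
      using F that by blast
  next
    fix i and lam :: "nat \<times> nat \<Rightarrow> 'k"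
    assume i: "i < length xs" and "greedy TYPE('k) D xs i \<noteq> None \<and> greedy TYPE('k) D xs (Suc i) = None"
    then show "rows_dependent (Mmat D xs lam) (Suc i)" using abort by blast
    then show "mat_rank (Mmat D xs lam) < card (UU D)" by (rule rank_less[OF i])
  qed
qed

end
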